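(* There exist infinitely many (pairwise non-isomorphic) Coxeter systems $(\Gamma,S)$ that are non-spherical, non-affine, non-hyperbolic, of dimension at most $2$, with $\chi(L(\Gamma,S))\leq -1$, and whose growth rates $\tau(\Gamma,S)$ are Perron numbers.
   Context: A Coxeter system $(\Gamma,S)$ of rank $N$ is a group $\Gamma$ with finite generating set $S=\{s_1,\dots,s_N\}$ and presentation $\langle s_1,\dots,s_N \mid (s_is_j)^{k_{ij}},\ 1\le i,j\le N\rangle$, where $k_{ii}=1$ and $k_{ij}=k_{ji}\in\{2,3,\dots\}\cup\{\infty\}$ for $i\neq j$; $k_{ij}$ is the order of $s_is_j$, and $k_{ij}=\infty$ means that there is no relation. Two Coxeter systems are isomorphic if there is a bijection of the generating sets preserving all $k_{ij}$. The cosine matrix $C=(c_{ij})\in M_N(\mathbb{R})$ has $c_{ij}=-\cos(\pi/k_{ij})$ if $k_{ij}<\infty$ and $c_{ij}=-1$ if $k_{ij}=\infty$. The system is spherical if $C$ is positive definite and affine if $C$ is positive semidefinite; thus non-spherical and non-affine means that $C$ is not positive semidefinite. An $n$-dimensional hyperbolic Coxeter polytope $P\subset\mathbb{H}^n$ is an intersection of finitely many half-spaces of hyperbolic space $\mathbb{H}^n$ with nonempty interior, all of whose dihedral angles are of the form $\pi/k$ with $k\ge2$ an integer or equal to zero. The set $S_P$ of reflections in the bounding hyperplanes of $P$ generates a discrete subgroup $\Gamma_P$ of $\mathrm{Isom}(\mathbb{H}^n)$, and $(\Gamma_P,S_P)$ is a Coxeter system. A Coxeter system is hyperbolic if it is isomorphic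 to $(\Gamma_P,S_P)$ for some hyperbolic Coxeter polytope $P\subset\mathbb{H}^n$, $n\ge 2$, and non-hyperbolic otherwise. The nerve $L(\Gamma,S)$ is the abstract simplicial complex with vertex set $S$ in which a nonempty subset $T\subset S$ spans a simplex (of dimension $\#T-1$) if and only if the subgroup $\Gamma_T$ generated by $T$ is finite. The dimension of $(\Gamma,S)$ is $\dim L(\Gamma,S)+1$, i.e. the maximal cardinality of a subset of $S$ generating a finite subgroup. If the dimension is at most $2$, $L(\Gamma,S)$ is a graph, with an edge between $s_i\ne s_j$ exactly when $k_{ij}<\infty$, and $\chi(L(\Gamma,S))$ is its number of vertices minus its number of edges. The growth rate is $\tau(\Gamma,S)=\limsup_{\ell\to\infty}\sqrt[\ell]{a_\ell}$, where $a_\ell$ is the number of elements of $\Gamma$ of word length $\ell$ with respect to $S$. A Perron number is a real algebraic integer $\tau>1$ such that $\tau$ is an integer or all of its other Galois conjugates are strictly less than $\tau$ in absolute value. *)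

theory Defs
  imports
    "HOL-Algebra.Multiplicative_Group"
    "HOL-Algebra.Elementary_Groups"
    "HOL-Algebra.Bij"
    "HOL-Computational_Algebra.Polynomial_Factorial"
    "HOL-Library.Extended_Real"
begin

section \<open>Group presentations\<close>

text \<open>
  A letter \<open>(s, True)\<close> stands for the generator \<open>s\<close> and \<open>(s, False)\<close> for its formal inverse.
\<close>

type_synonym 'a word = "('a \<times> bool) list"

definition letters :: "'a set \<Rightarrow> ('a \<times> bool) set" where
  "letters S = S \<times> UNIV"

text \<open>
  Two words over \<open>S\<close> are related iff they represent the same element of the group
  \<open>\<langle>S | R\<rangle>\<close>, i.e. of the quotient of the free group on \<open>S\<close> by the normal closure of \<open>R\<close>.
\<close>

inductive word_equiv :: "'a set \<Rightarrow> 'a word set \<Rightarrow> 'a word \<Rightarrow> 'a word \<Rightarrow> bool"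
  for S :: "'a set" and R :: "'a word set" where
  refl: "w \<in> lists (letters S) \<Longrightarrow> word_equiv S R w w"
| sym: "word_equiv S R v w \<Longrightarrow> word_equiv S R w v"
| trans: "word_equiv S R u v \<Longrightarrow> word_equiv S R v w \<Longrightarrow> word_equiv S R u w"
| cancel: "u \<in> lists (letters S) \<Longrightarrow> v \<in> lists (letters S) \<Longrightarrow> s \<in> S \<Longrightarrow>
    word_equiv S R (u @ [(s, b), (s, \<not> b)] @ v) (u @ v)"
| relator: "u \<in> lists (letters S) \<Longrightarrow> v \<in> lists (letters S) \<Longrightarrow> r \<in> R \<Longrightarrow>
    word_equiv S R (u @ r @ v) (u @ v)"

definition eval_letter :: "('a, 'b) monoid_scheme \<Rightarrow> 'a \<times> bool \<Rightarrow> 'a" where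
  "eval_letter G l = (if snd l then fst l else inv\<^bsub>G\<^esub> (fst l))"

definition eval_word :: "('a, 'b) monoid_scheme \<Rightarrow> 'a word \<Rightarrow> 'a" where
  "eval_word G w = foldr (\<lambda>l g. eval_letter G l \<otimes>\<^bsub>G\<^esub> g) w \<one>\<^bsub>G\<^esub>"

text \<open>
  The evaluation map from words to \<open>G\<close> induces an isomorphism from \<open>\<langle>S | R\<rangle>\<close> onto \<open>G\<close>.
\<close>

definition has_presentation :: "('a, 'b) monoid_scheme \<Rightarrow> 'a set \<Rightarrow> 'a word set \<Rightarrow> bool" where
  "has_presentation G S R \<longleftrightarrow>
     group G \<and> S \<subseteq> carrier G \<and> R \<subseteq> lists (letters S) \<and>
     eval_word G ` lists (letters S) = carrier G \<and>
     (\<forall>v\<in>lists (letters S). \<forall>w\<in>lists (letters S).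
        eval_word G v = eval_word G w \<longleftrightarrow> word_equiv S R v w)"


section \<open>Coxeter systems\<close>

text \<open>
  The generators themselves serve as indices of the Coxeter matrix. Throughout, the label
  \<open>\<infinity>\<close> is represented by \<open>0\<close>, in accordance with \<^const>\<open>group.ord\<close>, which is \<open>0\<close> on elements of
  infinite order.
\<close>

definition cox_label :: "('a, 'b) monoid_scheme \<Rightarrow> 'a \<Rightarrow> 'a \<Rightarrow> nat" where
  "cox_label G s t = group.ord G (s \<otimes>\<^bsub>G\<^esub> t)"

definition coxeter_matrix :: "'a set \<Rightarrow> ('a \<Rightarrow> 'a \<Rightarrow> nat) \<Rightarrow> bool" where
  "coxeter_matrix S k \<longleftrightarrow>
     (\<forall>s\<in>S. k s s = 1) \<and>
     (\<forall>s\<in>S. \<forall>t\<in>S. k s t = k t s) \<and>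
     (\<forall>s\<in>S. \<forall>t\<in>S. s \<noteq> t \<longrightarrow> k s t = 0 \<or> k s t \<ge> 2)"

definition coxeter_relators :: "'a set \<Rightarrow> ('a \<Rightarrow> 'a \<Rightarrow> nat) \<Rightarrow> 'a word set" where
  "coxeter_relators S k =
     {concat (replicate (k s t) [(s, True), (t, True)]) | s t. s \<in> S \<and> t \<in> S \<and> k s t \<noteq> 0}"

definition coxeter_system :: "('a, 'b) monoid_scheme \<Rightarrow> 'a set \<Rightarrow> bool" where
  "coxeter_system G S \<longleftrightarrow>
     group G \<and> finite S \<and> S \<subseteq> carrier G \<and>
     coxeter_matrix S (cox_label G) \<and>
     has_presentation G S (coxeter_relators S (cox_label G))"

definition coxeter_iso ::
  "('a, 'c) monoid_scheme \<Rightarrow> 'a set \<Rightarrow> ('b, 'd) monoid_scheme \<Rightarrow> 'b set \<Rightarrow> bool" where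
  "coxeter_iso G S H T \<longleftrightarrow>
     (\<exists>f. bij_betw f S T \<and> (\<forall>s\<in>S. \<forall>t\<in>S. cox_label H (f s) (f t) = cox_label G s t))"

definition cosine_matrix :: "('a, 'b) monoid_scheme \<Rightarrow> 'a \<Rightarrow> 'a \<Rightarrow> real" where
  "cosine_matrix G s t =
     (if cox_label G s t = 0 then -1 else - cos (pi / real (cox_label G s t)))"

definition positive_definite_on :: "'a set \<Rightarrow> ('a \<Rightarrow> 'a \<Rightarrow> real) \<Rightarrow> bool" where
  "positive_definite_on S C \<longleftrightarrow>
     (\<forall>x. (\<exists>s\<in>S. x s \<noteq> 0) \<longrightarrow> (\<Sum>s\<in>S. \<Sum>t\<in>S. x s * C s t * x t) > 0)"

definition positive_semidefinite_on :: "'a set \<Rightarrow> ('a \<Rightarrow> 'a \<Rightarrow> real) \<Rightarrow> bool" where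
  "positive_semidefinite_on S C \<longleftrightarrow>
     (\<forall>x. (\<Sum>s\<in>S. \<Sum>t\<in>S. x s * C s t * x t) \<ge> 0)"

definition spherical :: "('a, 'b) monoid_scheme \<Rightarrow> 'a set \<Rightarrow> bool" where
  "spherical G S \<longleftrightarrow> positive_definite_on S (cosine_matrix G)"

definition affine_system :: "('a, 'b) monoid_scheme \<Rightarrow> 'a set \<Rightarrow> bool" where
  "affine_system G S \<longleftrightarrow> positive_semidefinite_on S (cosine_matrix G)"


section \<open>Nerve, dimension and Euler characteristic\<close>

text \<open>A simplicial complex is given by the set of its (nonempty) simplices.\<close>

definition nerve :: "('a, 'b) monoid_scheme \<Rightarrow> 'a set \<Rightarrow> 'a set set" where
  "nerve G S = {T. T \<subseteq> S \<and> T \<noteq> {} \<and> finite (generate G T)}"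

text \<open>The empty complex has dimension \<open>-1\<close>.\<close>

definition complex_dim :: "'a set set \<Rightarrow> int" where
  "complex_dim K = int (Max (card ` insert {} K)) - 1"

definition euler_char :: "'a set set \<Rightarrow> int" where
  "euler_char K = (\<Sum>\<sigma>\<in>K. (-1) ^ (card \<sigma> - 1))"

definition coxeter_dim :: "('a, 'b) monoid_scheme \<Rightarrow> 'a set \<Rightarrow> int" where
  "coxeter_dim G S = complex_dim (nerve G S) + 1"


section \<open>Growth rate\<close>

text \<open>
  Only used for generating sets consisting of involutions, so that words need no
  inverses of generators.
\<close>

definition word_length :: "('a, 'b) monoid_scheme \<Rightarrow> 'a set \<Rightarrow> 'a \<Rightarrow> nat" where
  "word_length G S g =
     (LEAST l. \<exists>w\<in>lists S. length w = l \<and> foldr (\<lambda>s h. s \<otimes>\<^bsub>G\<^esub> h) w \<one>\<^bsub>G\<^esub> = g)"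

definition growth_coeff :: "('a, 'b) monoid_scheme \<Rightarrow> 'a set \<Rightarrow> nat \<Rightarrow> nat" where
  "growth_coeff G S l = card {g \<in> carrier G. word_length G S g = l}"

text \<open>
  For finite \<open>S\<close> the sequence is bounded by \<open>card S\<close> for \<open>l > 0\<close>, hence the limit superior is a real number.
\<close>

definition growth_rate :: "('a, 'b) monoid_scheme \<Rightarrow> 'a set \<Rightarrow> real" where
  "growth_rate G S =
     real_of_ereal (limsup (\<lambda>l. ereal (root l (real (growth_coeff G S l)))))"


section \<open>Perron numbers\<close>

text \<open>
  \<open>z\<close> is a Galois conjugate of \<open>x\<close> iff both are roots of the same irreducible rational polynomial
  (which is, up to a scalar, the minimal polynomial of \<open>x\<close>).
\<close>

definition galois_conjugate :: "complex \<Rightarrow> complex \<Rightarrow> bool" where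
  "galois_conjugate x z \<longleftrightarrow>
     (\<exists>p :: rat poly. Factorial_Ring.irreducible p \<and>
        poly (map_poly of_rat p) x = 0 \<and> poly (map_poly of_rat p) z = 0)"

definition perron_number :: "real \<Rightarrow> bool" where
  "perron_number \<tau> \<longleftrightarrow>
     algebraic_int \<tau> \<and> \<tau> > 1 \<and>
     (\<tau> \<in> \<int> \<or> (\<forall>z. galois_conjugate (complex_of_real \<tau>) z \<and> z \<noteq> complex_of_real \<tau> \<longrightarrow> cmod z < \<tau>))"


section \<open>Hyperbolic space\<close>

text \<open>
  The hyperboloid model. Since the dimension \<open>n\<close> is a variable of the formulas below, the vectors
  \<open>(x 0, \<dots>, x n)\<close> of Minkowski space are represented by functions vanishing beyond \<open>n\<close>.
\<close>

definition minkowski_space :: "nat \<Rightarrow> (nat \<Rightarrow> real) set" where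
  "minkowski_space n = {x. \<forall>i>n. x i = 0}"

definition lorentz :: "nat \<Rightarrow> (nat \<Rightarrow> real) \<Rightarrow> (nat \<Rightarrow> real) \<Rightarrow> real" where
  "lorentz n x y = - (x 0 * y 0) + (\<Sum>i=1..n. x i * y i)"

definition hyp_space :: "nat \<Rightarrow> (nat \<Rightarrow> real) set" where
  "hyp_space n = {x \<in> minkowski_space n. lorentz n x x = -1 \<and> x 0 > 0}"

definition hyp_dist :: "nat \<Rightarrow> (nat \<Rightarrow> real) \<Rightarrow> (nat \<Rightarrow> real) \<Rightarrow> real" where
  "hyp_dist n x y = arcosh (- lorentz n x y)"

definition hyp_isometries :: "nat \<Rightarrow> ((nat \<Rightarrow> real) \<Rightarrow> (nat \<Rightarrow> real)) set" where
  "hyp_isometries n = {f \<in> Bij (hyp_space n).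
     \<forall>x\<in>hyp_space n. \<forall>y\<in>hyp_space n. hyp_dist n (f x) (f y) = hyp_dist n x y}"

definition Isom_hyp :: "nat \<Rightarrow> ((nat \<Rightarrow> real) \<Rightarrow> (nat \<Rightarrow> real)) monoid" where
  "Isom_hyp n = (BijGroup (hyp_space n))\<lparr>carrier := hyp_isometries n\<rparr>"

text \<open>
  Unit spacelike vectors \<open>e\<close> parametrise the closed half-spaces; \<open>e\<close> is the outer unit normal.
\<close>

definition unit_normals :: "nat \<Rightarrow> (nat \<Rightarrow> real) set" where
  "unit_normals n = {e \<in> minkowski_space n. lorentz n e e = 1}"

definition hyp_halfspace :: "nat \<Rightarrow> (nat \<Rightarrow> real) \<Rightarrow> (nat \<Rightarrow> real) set" where
  "hyp_halfspace n e = {x \<in> hyp_space n. lorentz n x e \<le> 0}"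

definition hyp_hyperplane :: "nat \<Rightarrow> (nat \<Rightarrow> real) \<Rightarrow> (nat \<Rightarrow> real) set" where
  "hyp_hyperplane n e = {x \<in> hyp_space n. lorentz n x e = 0}"

definition hyp_reflection :: "nat \<Rightarrow> (nat \<Rightarrow> real) \<Rightarrow> (nat \<Rightarrow> real) \<Rightarrow> (nat \<Rightarrow> real)" where
  "hyp_reflection n e = (\<lambda>x\<in>hyp_space n. \<lambda>i. x i - 2 * lorentz n x e * e i)"


section \<open>Hyperbolic Coxeter polytopes\<close>

text \<open>
  The subset \<open>A\<close> of the subspace \<open>X\<close> of hyperbolic space has nonempty interior relative to \<open>X\<close>.
\<close>

definition nonempty_interior_in :: "nat \<Rightarrow> (nat \<Rightarrow> real) set \<Rightarrow> (nat \<Rightarrow> real) set \<Rightarrow> bool" where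
  "nonempty_interior_in n X A \<longleftrightarrow>
     (\<exists>x\<in>A. \<exists>\<epsilon>>0. \<forall>y\<in>X. hyp_dist n x y < \<epsilon> \<longrightarrow> y \<in> A)"

definition hyp_polytope :: "nat \<Rightarrow> (nat \<Rightarrow> real) set \<Rightarrow> bool" where
  "hyp_polytope n P \<longleftrightarrow>
     (\<exists>E. finite E \<and> E \<subseteq> unit_normals n \<and>
        P = hyp_space n \<inter> (\<Inter>e\<in>E. hyp_halfspace n e)) \<and>
     nonempty_interior_in n (hyp_space n) P"

text \<open>
  The outer unit normals of the facets of \<open>P\<close>; their hyperplanes are the bounding hyperplanes.
\<close>

definition facet_normals :: "nat \<Rightarrow> (nat \<Rightarrow> real) set \<Rightarrow> (nat \<Rightarrow> real) set" where
  "facet_normals n P = {e \<in> unit_normals n.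
     P \<subseteq> hyp_halfspace n e \<and>
     nonempty_interior_in n (hyp_hyperplane n e) (hyp_hyperplane n e \<inter> P)}"

text \<open>
  Two facets form a dihedral angle if they meet in a face of codimension two, i.e. if \<open>P\<close> contains
  a nonempty relatively open part of the intersection of their hyperplanes; the angle inside \<open>P\<close> is
  then \<open>\<pi>\<close> minus the angle between the outer normals. It is zero if the two hyperplanes are
  parallel (i.e. meet only at infinity), and undefined if they are ultraparallel.
\<close>

definition has_dihedral_angle ::
  "nat \<Rightarrow> (nat \<Rightarrow> real) set \<Rightarrow> (nat \<Rightarrow> real) \<Rightarrow> (nat \<Rightarrow> real) \<Rightarrow> real \<Rightarrow> bool" where
  "has_dihedral_angle n P e f \<theta> \<longleftrightarrow>
     e \<in> facet_normals n P \<and> f \<in> facet_normals n P \<and> e \<noteq> f \<and>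
     (nonempty_interior_in n (hyp_hyperplane n e \<inter> hyp_hyperplane n f)
        (hyp_hyperplane n e \<inter> hyp_hyperplane n f \<inter> P) \<and> \<theta> = arccos (- lorentz n e f) \<or>
      lorentz n e f = -1 \<and> \<theta> = 0)"

definition hyp_coxeter_polytope :: "nat \<Rightarrow> (nat \<Rightarrow> real) set \<Rightarrow> bool" where
  "hyp_coxeter_polytope n P \<longleftrightarrow>
     hyp_polytope n P \<and>
     (\<forall>e f \<theta>. has_dihedral_angle n P e f \<theta> \<longrightarrow> \<theta> = 0 \<or> (\<exists>k::nat. k \<ge> 2 \<and> \<theta> = pi / real k))"

definition polytope_reflections ::
  "nat \<Rightarrow> (nat \<Rightarrow> real) set \<Rightarrow> ((nat \<Rightarrow> real) \<Rightarrow> (nat \<Rightarrow> real)) set" where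
  "polytope_reflections n P = hyp_reflection n ` facet_normals n P"

definition polytope_group ::
  "nat \<Rightarrow> (nat \<Rightarrow> real) set \<Rightarrow> ((nat \<Rightarrow> real) \<Rightarrow> (nat \<Rightarrow> real)) monoid" where
  "polytope_group n P = subgroup_generated (Isom_hyp n) (polytope_reflections n P)"

definition hyperbolic_system :: "('a, 'b) monoid_scheme \<Rightarrow> 'a set \<Rightarrow> bool" where
  "hyperbolic_system G S \<longleftrightarrow>
     (\<exists>n P. n \<ge> 2 \<and> hyp_coxeter_polytope n P \<and>
        coxeter_iso G S (polytope_group n P) (polytope_reflections n P))"

end

theory Submission
  imports Defs "HOL-Analysis.Convex" "HOL-Algebra.Weak_Morphisms"
begin

text \<open>
  Let \<open>W\<close> be the free product of \<open>n \<ge> 3\<close> groups of order 2. The systems are the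
  products \<open>W \<times> W\<close>, one for every \<open>n\<close>. Two generators have the label
  \<open>\<infinity>\<close> if they come from the same factor and 2 otherwise, so the nerve is the complete
  bipartite graph \<open>K(n, n)\<close> and its Euler characteristic is \<open>2 n - n\<^sup>2 \<le>
  -3\<close>. The rank \<open>2 n\<close> distinguishes the systems. On the sum of the basis vectors of one
  factor the cosine matrix takes the value \<open>n (2 - n) < 0\<close>.

  The growth rate is the integer \<open>n - 1 \<ge> 2\<close>, which is a Perron number for trivial reasons:
  there are \<open>n (n - 1)\<^sup>l\<close> reduced words of length \<open>l + 1\<close> in \<open>W\<close>,
  so the spheres of \<open>W \<times> W\<close> grow like \<open>(n - 1)\<^sup>l\<close> up to a polynomial
  factor.

  The group is built on pairs of reduced words. Prepending a letter with cancellation is an involution on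
  reduced words; this gives the group laws, and the letters of a pair, in order, form a word to which every
  word can be transformed by the Coxeter relators (\<open>equivalent_normal_form\<close>). This proves the
  presentation and computes labels and word lengths.

  The main point is that \<open>W \<times> W\<close> is not hyperbolic in any dimension. Suppose that it is
  the reflection group of a Coxeter polytope \<open>P\<close>. The outer normals of its facets split into two
  classes. Normals from different classes are orthogonal because their reflections commute
  (\<open>cox_label_2_orth\<close>). Normals \<open>e\<close>, \<open>f\<close> from the same class satisfy
  \<open>\<langle>e, f\<rangle> \<le> -1\<close>, where \<open>\<langle>e, f\<rangle>\<close> is the Lorentz
  product. Hence the sum of three normals of one class is timelike, and so is the sum of three normals of the
  other class. These sums are orthogonal, but the Lorentz form has only one negative direction
  (\<open>timelike_orth_spacelike\<close>).

  The inequality does not follow from the order of the product of the two reflections alone, since the angle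
  condition concerns only pairs of facets that meet. Values \<open>\<ge> 1\<close> are excluded because
  half-spaces of two facets are not nested (\<open>facet_lorentz_less_1\<close>). If \<open>-1 < \<langle>e,
  f\<rangle> < 1\<close>, then walking on the facet of \<open>e\<close> towards the hyperplane of
  \<open>f\<close> one leaves \<open>P\<close> through a facet adjacent to \<open>e\<close>
  (\<open>adjacent_facet_exists\<close>). It cannot belong to the other class, whose normals are orthogonal to
  the direction of the walk. So it belongs to the class of \<open>e\<close>, and the dihedral angle
  \<open>\<pi> / k\<close> contradicts the infinite order of the product of the reflections
  (\<open>infinite_label_lorentz_le\<close>).
\<close>

section \<open>Lorentzian geometry\<close>

text \<open>
  The type \<open>nat \<Rightarrow> real\<close> is used without a vector space structure, so linear
  combinations get a name; the Lorentz form then expands over them by simplification.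
\<close>

definition lin_comb :: "real \<Rightarrow> (nat \<Rightarrow> real) \<Rightarrow> real \<Rightarrow> (nat \<Rightarrow> real) \<Rightarrow> nat \<Rightarrow> real" where
  "lin_comb a x b y = (\<lambda>i. a * x i + b * y i)"

text \<open>
  Constructions below add and subtract points of hyperbolic space. They are carried out in the open cone over
  it, where no square roots occur, and projected back by \<open>normalise\<close>.
\<close>

definition future_cone :: "nat \<Rightarrow> (nat \<Rightarrow> real) set" where
  "future_cone n = {x \<in> minkowski_space n. lorentz n x x < 0 \<and> x 0 > 0}"

definition normalise :: "nat \<Rightarrow> (nat \<Rightarrow> real) \<Rightarrow> nat \<Rightarrow> real" where
  "normalise n x = lin_comb (1 / sqrt (- lorentz n x x)) x 0 x"

lemma lorentz_sym: "lorentz n x y = lorentz n y x"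
  by (simp add: lorentz_def mult.commute)

lemma lorentz_lin_comb_left [simp]:
  "lorentz n (lin_comb a x b y) z = a * lorentz n x z + b * lorentz n y z"
  by (simp add: lorentz_def lin_comb_def algebra_simps sum.distrib sum_distrib_left)

lemma lorentz_lin_comb_right [simp]:
  "lorentz n z (lin_comb a x b y) = a * lorentz n z x + b * lorentz n z y"
  by (simp add: lorentz_sym[of n z])

lemma lin_comb_0 [simp]: "lin_comb a x b y 0 = a * x 0 + b * y 0"
  by (simp add: lin_comb_def)

lemma lin_comb_minkowski [simp]:
  "x \<in> minkowski_space n \<Longrightarrow> y \<in> minkowski_space n \<Longrightarrow> lin_comb a x b y \<in> minkowski_space n"
  by (simp add: minkowski_space_def lin_comb_def)

lemma unit_normals_minkowski: "e \<in> unit_normals n \<Longrightarrow> e \<in> minkowski_space n"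
  by (simp add: unit_normals_def)

lemma hyp_space_future_cone: "x \<in> hyp_space n \<Longrightarrow> x \<in> future_cone n"
  by (simp add: hyp_space_def future_cone_def)

lemma future_cone_minkowski: "x \<in> future_cone n \<Longrightarrow> x \<in> minkowski_space n"
  by (simp add: future_cone_def)

text \<open>
  The form has only one negative direction: if \<open>x\<close> takes it up, the orthogonal complement of
  \<open>x\<close> is positive definite. From \<open>x 0 * v 0 = \<Sum> x i * v i\<close> and the
  Cauchy-Schwarz inequality, \<open>(x 0)\<^sup>2 * (v 0)\<^sup>2\<close> is at most \<open>(\<Sum> (x
  i)\<^sup>2) * (\<Sum> (v i)\<^sup>2)\<close>, whose first factor is less than \<open>(x 0)\<^sup>2\<close>.
\<close>

lemma timelike_orth_spacelike:
  assumes "lorentz n x x < 0" "v \<in> minkowski_space n" "lorentz n x v = 0" "v \<noteq> (\<lambda>_. 0)"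
  shows "lorentz n v v > 0"
proof -
  define X where "X = (\<Sum>i=1..n. (x i)\<^sup>2)"
  define V where "V = (\<Sum>i=1..n. (v i)\<^sup>2)"
  have X: "X < (x 0)\<^sup>2" "X \<ge> 0" and V: "V \<ge> 0" "lorentz n v v = V - (v 0)\<^sup>2"
    using assms(1) by (auto simp: lorentz_def X_def V_def power2_eq_square sum_nonneg)
  have cs: "(x 0 * v 0)\<^sup>2 \<le> X * V"
  proof -
    have "x 0 * v 0 = (\<Sum>i=1..n. x i * v i)"
      using assms(3) by (simp add: lorentz_def)
    then show ?thesis
      using Cauchy_Schwarz_ineq_sum[of x v "{1..n}"] by (simp add: X_def V_def)
  qed
  have "V \<noteq> 0"
  proof
    assume "V = 0"
    then have "\<forall>i\<in>{1..n}. v i = 0"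
      unfolding V_def by (subst (asm) sum_nonneg_eq_0_iff) auto
    moreover from cs X \<open>V = 0\<close> have "v 0 = 0"
      by auto
    ultimately have "v i = 0" for i
      using assms(2) by (cases "i = 0"; cases "i \<le> n") (auto simp: minkowski_space_def)
    then show False
      using assms(4) by auto
  qed
  with V have "V > 0" by simp
  then have "X * V < (x 0)\<^sup>2 * V"
    using X by (intro mult_strict_right_mono)
  then have "(x 0)\<^sup>2 * (v 0)\<^sup>2 < (x 0)\<^sup>2 * V"
    using cs by (simp only: power_mult_distrib)
  moreover have "(x 0)\<^sup>2 > 0" using X by linarith
  ultimately show ?thesis
    using V(2) by (simp add: mult_less_cancel_left_pos)
qed

lemma future_cone_lorentz_neg:
  assumes "x \<in> future_cone n" "y \<in> future_cone n"
  shows "lorentz n x y < 0"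
proof (rule ccontr)
  assume c: "\<not> lorentz n x y < 0"
  define X where "X = (\<Sum>i=1..n. (x i)\<^sup>2)"
  define Y where "Y = (\<Sum>i=1..n. (y i)\<^sup>2)"
  have X: "X < (x 0)\<^sup>2" "X \<ge> 0" "x 0 > 0" and Y: "Y < (y 0)\<^sup>2" "Y \<ge> 0" "y 0 > 0"
    using assms by (auto simp: future_cone_def lorentz_def X_def Y_def power2_eq_square sum_nonneg)
  have "x 0 * y 0 \<le> (\<Sum>i=1..n. x i * y i)"
    using c by (simp add: lorentz_def)
  then have "(x 0 * y 0)\<^sup>2 \<le> (\<Sum>i=1..n. x i * y i)\<^sup>2"
    using X Y by (intro power_mono) auto
  also have "\<dots> \<le> X * Y"
    unfolding X_def Y_def by (rule Cauchy_Schwarz_ineq_sum)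
  also have "\<dots> < (x 0)\<^sup>2 * (y 0)\<^sup>2"
    using X Y by (intro mult_strict_mono) auto
  finally show False by (simp add: power_mult_distrib)
qed

lemma future_coneI:
  assumes "x \<in> future_cone n" "y \<in> minkowski_space n" "lorentz n y y < 0" "lorentz n x y \<le> 0"
  shows "y \<in> future_cone n"
proof -
  have "y 0 \<noteq> 0"
  proof
    assume "y 0 = 0"
    then have "lorentz n y y \<ge> 0" by (simp add: lorentz_def sum_nonneg)
    then show False using assms(3) by simp
  qed
  moreover have "\<not> y 0 < 0"
  proof
    assume "y 0 < 0"
    then have "lin_comb (-1) y 0 y \<in> future_cone n"
      using assms(2,3) by (simp add: future_cone_def)
    from future_cone_lorentz_neg[OF assms(1) this] show False
      using assms(4) by simp
  qed
  ultimately show ?thesis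
    using assms(2,3) by (simp add: future_cone_def)
qed

lemma future_cone_lin_comb:
  assumes "x \<in> future_cone n" "y \<in> future_cone n" "a \<ge> 0" "b \<ge> 0" "a + b > 0"
  shows "lin_comb a x b y \<in> future_cone n"
proof -
  have n: "lorentz n x y < 0" "lorentz n x x < 0" "lorentz n y y < 0" "x 0 > 0" "y 0 > 0"
    using assms(1,2) future_cone_lorentz_neg[OF assms(1,2)] by (auto simp: future_cone_def)
  have "a > 0 \<or> b > 0" using assms by linarith
  then have "a * x 0 + b * y 0 > 0"
    using n assms(3,4) by (auto intro: add_pos_nonneg add_nonneg_pos)
  moreover have "lorentz n (lin_comb a x b y) (lin_comb a x b y)
     = (a * a) * lorentz n x x + 2 * (a * b) * lorentz n x y + (b * b) * lorentz n y y"
    by (simp add: algebra_simps lorentz_sym[of n y x])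
  moreover have "(a * a) * lorentz n x x \<le> 0" "(b * b) * lorentz n y y \<le> 0"
      "2 * (a * b) * lorentz n x y \<le> 0"
    using n assms(3,4) by (auto simp: mult_le_0_iff)
  moreover have "(a * a) * lorentz n x x < 0 \<or> (b * b) * lorentz n y y < 0"
    using n \<open>a > 0 \<or> b > 0\<close> by (auto simp: mult_less_0_iff)
  ultimately show ?thesis
    using assms(1,2) unfolding future_cone_def by (auto simp del: lorentz_lin_comb_left lorentz_lin_comb_right)
qed

lemma normalise_hyp_space:
  assumes "x \<in> future_cone n"
  shows "normalise n x \<in> hyp_space n"
proof -
  have "lorentz n x x < 0" "x 0 > 0" "x \<in> minkowski_space n"
    using assms by (auto simp: future_cone_def)
  then show ?thesis
    by (simp add: normalise_def hyp_space_def field_simps)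
qed

lemma lorentz_normalise:
  "lorentz n (normalise n x) y = lorentz n x y / sqrt (- lorentz n x x)"
  by (simp add: normalise_def)

lemma lorentz_normalise_iff:
  assumes "x \<in> future_cone n"
  shows "lorentz n (normalise n x) y \<le> 0 \<longleftrightarrow> lorentz n x y \<le> 0"
    "lorentz n (normalise n x) y = 0 \<longleftrightarrow> lorentz n x y = 0"
    "lorentz n (normalise n x) y < 0 \<longleftrightarrow> lorentz n x y < 0"
proof -
  have "sqrt (- lorentz n x x) > 0"
    using assms by (auto simp: future_cone_def)
  then show "lorentz n (normalise n x) y \<le> 0 \<longleftrightarrow> lorentz n x y \<le> 0"
    "lorentz n (normalise n x) y = 0 \<longleftrightarrow> lorentz n x y = 0"
    "lorentz n (normalise n x) y < 0 \<longleftrightarrow> lorentz n x y < 0"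
    by (auto simp: lorentz_normalise divide_le_0_iff divide_less_0_iff)
qed

text \<open>
  The component of \<open>y\<close> orthogonal to \<open>x\<close> has norm \<open>(lorentz n x y)\<^sup>2 -
  1\<close>, which cannot be negative.
\<close>

lemma hyp_space_lorentz_le:
  assumes "x \<in> hyp_space n" "y \<in> hyp_space n"
  shows "lorentz n x y \<le> -1"
proof -
  define c where "c = lorentz n x y"
  have c: "c < 0"
    unfolding c_def using assms by (intro future_cone_lorentz_neg hyp_space_future_cone)
  have x: "lorentz n x x = -1" "lorentz n y y = -1" "x \<in> minkowski_space n" "y \<in> minkowski_space n"
    using assms by (auto simp: hyp_space_def)
  define w where "w = lin_comb 1 y c x"
  have w: "lorentz n x w = 0" "lorentz n w w = c * c - 1" "w \<in> minkowski_space n"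
    using x by (auto simp: w_def c_def lorentz_sym[of n y x] lorentz_sym[of n w x] algebra_simps)
  have "lorentz n w w \<ge> 0"
  proof (cases "w = (\<lambda>_. 0)")
    case True
    then show ?thesis by (simp add: lorentz_def)
  next
    case False
    then show ?thesis
      using timelike_orth_spacelike[of n x w] w x by simp
  qed
  then have "1 \<le> (-c)\<^sup>2" using w by (simp add: power2_eq_square)
  then have "1 \<le> -c"
    using c power2_le_imp_le[of 1 "-c"] by simp
  then show ?thesis by (simp add: c_def)
qed

lemma hyp_dist_less_iff:
  assumes "x \<in> hyp_space n" "y \<in> hyp_space n" "\<epsilon> > 0"
  shows "hyp_dist n x y < \<epsilon> \<longleftrightarrow> - lorentz n x y < cosh \<epsilon>"
proof -
  have "hyp_dist n x y < arcosh (cosh \<epsilon>) \<longleftrightarrow> - lorentz n x y < cosh \<epsilon>"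
    unfolding hyp_dist_def using hyp_space_lorentz_le[OF assms(1,2)] assms(3)
    by (intro arcosh_less_iff_real) (auto simp: cosh_real_ge_1)
  then show ?thesis
    using assms(3) by (simp add: arcosh_cosh_real)
qed

text \<open>
  All perturbations below go along a ray \<open>x + t v\<close> with \<open>t\<close> small and positive; the
  next lemmas say which strict conditions survive.
\<close>

lemma eventually_lin_comb_future_cone:
  assumes "x \<in> future_cone n" "v \<in> minkowski_space n"
  shows "\<forall>\<^sub>F t in at_right 0. lin_comb 1 x t v \<in> future_cone n"
proof -
  have x: "lorentz n x x < 0" "x 0 > 0" "x \<in> minkowski_space n"
    using assms by (auto simp: future_cone_def)
  have "((\<lambda>t. lorentz n (lin_comb 1 x t v) (lin_comb 1 x t v)) \<longlongrightarrow> lorentz n x x + 0 * lorentz n x v + 0 * (lorentz n v x + 0 * lorentz n v v)) (at_right 0)"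
    unfolding lorentz_lin_comb_left lorentz_lin_comb_right
    by (auto intro!: tendsto_eq_intros)
  then have "((\<lambda>t. lorentz n (lin_comb 1 x t v) (lin_comb 1 x t v)) \<longlongrightarrow> lorentz n x x) (at_right 0)"
    by simp
  from order_tendstoD(2)[OF this x(1)]
  have "\<forall>\<^sub>F t in at_right 0. lorentz n (lin_comb 1 x t v) (lin_comb 1 x t v) < 0" .
  moreover have "((\<lambda>t. lin_comb 1 x t v 0) \<longlongrightarrow> x 0) (at_right 0)"
    by (auto intro!: tendsto_eq_intros)
  from order_tendstoD(1)[OF this x(2)]
  have "\<forall>\<^sub>F t in at_right 0. lin_comb 1 x t v 0 > 0" .
  ultimately show ?thesis
    by eventually_elim (use assms x in \<open>simp add: future_cone_def del: lorentz_lin_comb_left lorentz_lin_comb_right\<close>)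
qed

lemma eventually_lorentz_neg:
  assumes "lorentz n x g < 0"
  shows "\<forall>\<^sub>F t in at_right 0. lorentz n (lin_comb 1 x t v) g < 0"
proof -
  have "((\<lambda>t. lorentz n (lin_comb 1 x t v) g) \<longlongrightarrow> lorentz n x g) (at_right 0)"
    by (auto intro!: tendsto_eq_intros)
  from order_tendstoD(2)[OF this assms] show ?thesis .
qed

lemma eventually_lorentz_nonzero:
  assumes "lorentz n x g \<noteq> 0"
  shows "\<forall>\<^sub>F t in at_right 0. lorentz n (lin_comb 1 x t v) g \<noteq> 0"
proof -
  have "((\<lambda>t. lorentz n (lin_comb 1 x t v) g) \<longlongrightarrow> lorentz n x g) (at_right 0)"
    by (auto intro!: tendsto_eq_intros)
  from tendsto_imp_eventually_ne[OF this assms] show ?thesis .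
qed

lemma eventually_hyp_dist_less:
  assumes "x \<in> hyp_space n" "v \<in> minkowski_space n" "\<epsilon> > 0"
  shows "\<forall>\<^sub>F t in at_right 0. hyp_dist n x (normalise n (lin_comb 1 x t v)) < \<epsilon>"
proof -
  let ?z = "\<lambda>t. lin_comb 1 x t v"
  have x: "lorentz n x x = -1"
    using assms by (auto simp: hyp_space_def)
  have "((\<lambda>t. - (lorentz n x (?z t) / sqrt (- lorentz n (?z t) (?z t)))) \<longlongrightarrow> 1) (at_right 0)"
    unfolding lorentz_lin_comb_left lorentz_lin_comb_right
    by (auto intro!: tendsto_eq_intros simp: x)
  moreover have "1 < cosh \<epsilon>"
    using assms(3) by (metis cosh_0 cosh_real_nonneg_less_iff less_eq_real_def order_refl)
  ultimately have "\<forall>\<^sub>F t in at_right 0. - (lorentz n x (?z t) / sqrt (- lorentz n (?z t) (?z t))) < cosh \<epsilon>"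
    by (rule order_tendstoD(2))
  moreover have "\<forall>\<^sub>F t in at_right 0. ?z t \<in> future_cone n"
    using assms by (intro eventually_lin_comb_future_cone hyp_space_future_cone)
  ultimately show ?thesis
  proof eventually_elim
    case (elim t)
    then show ?case
      using hyp_dist_less_iff[OF assms(1) normalise_hyp_space[OF elim(2)] assms(3)]
      by (simp add: lorentz_sym[of n x "normalise n _"] lorentz_normalise lorentz_sym[of n x "?z t"] del: lorentz_lin_comb_left lorentz_lin_comb_right)
  qed
qed

lemma timelike_orth_Cauchy_Schwarz:
  assumes "lorentz n x x < 0" "v \<in> minkowski_space n" "w \<in> minkowski_space n"
    "lorentz n x v = 0" "lorentz n x w = 0"
  shows "(lorentz n v w)\<^sup>2 \<le> lorentz n v v * lorentz n w w"
proof (cases "w = (\<lambda>_. 0)")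
  case True
  then show ?thesis by (simp add: lorentz_def)
next
  case False
  then have w: "lorentz n w w > 0"
    using timelike_orth_spacelike assms by blast
  define u where "u = lin_comb (lorentz n w w) v (- lorentz n v w) w"
  have u: "u \<in> minkowski_space n" "lorentz n x u = 0"
    "lorentz n u u = lorentz n w w * (lorentz n v v * lorentz n w w - (lorentz n v w)\<^sup>2)"
    using assms by (auto simp: u_def algebra_simps power2_eq_square lorentz_sym[of n w v])
  have "lorentz n u u \<ge> 0"
  proof (cases "u = (\<lambda>_. 0)")
    case True
    then show ?thesis by (simp add: lorentz_def)
  next
    case False
    then show ?thesis
      using timelike_orth_spacelike[of n x u] u assms by simp
  qed
  then show ?thesis
    using w u(3) by (simp add: zero_le_mult_iff)
qed

text \<open>
  A hyperplane missing \<open>x\<close> has positive distance from \<open>x\<close>: the components of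
  \<open>y\<close> and \<open>g\<close> orthogonal to \<open>x\<close> obey the Cauchy-Schwarz inequality, and
  that of \<open>y\<close> tends to zero as \<open>y\<close> approaches \<open>x\<close>.
\<close>

lemma lorentz_neg_near:
  assumes x: "x \<in> hyp_space n" and g: "g \<in> minkowski_space n" "lorentz n x g < 0"
  shows "\<exists>\<epsilon>>0. \<forall>y\<in>hyp_space n. hyp_dist n x y < \<epsilon> \<longrightarrow> lorentz n y g < 0"
proof -
  define a where "a = - lorentz n x g"
  \<comment> \<open>\<open>K\<close> is the norm of the component of \<open>g\<close> orthogonal to \<open>x\<close>; the components of \<open>y\<close> and \<open>g\<close> are \<open>w\<close> and \<open>h\<close> below.\<close>
  define K where "K = lorentz n g g + a\<^sup>2"
  have "((\<lambda>t. (cosh t)\<^sup>2 - 1) \<longlongrightarrow> 0) (at_right (0::real))"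
    by (auto intro!: tendsto_eq_intros)
  then have lim: "((\<lambda>t. ((cosh t)\<^sup>2 - 1) * K) \<longlongrightarrow> 0) (at_right (0::real))"
    by (auto intro!: tendsto_eq_intros)
  have "0 < a\<^sup>2" using g by (simp add: a_def)
  from order_tendstoD(2)[OF lim this]
  have "\<forall>\<^sub>F t in at_right 0. ((cosh t)\<^sup>2 - 1) * K < a\<^sup>2" .
  moreover have "\<forall>\<^sub>F t in at_right (0::real). t > 0"
    by (simp add: eventually_at_right_less)
  ultimately have "\<forall>\<^sub>F t in at_right 0. t > 0 \<and> ((cosh t)\<^sup>2 - 1) * K < a\<^sup>2"
    by eventually_elim simp
  then obtain \<epsilon> where eps: "\<epsilon> > 0" "((cosh \<epsilon>)\<^sup>2 - 1) * K < a\<^sup>2"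
    using eventually_happens'[OF trivial_limit_at_right_real] by blast
  have "lorentz n y g < 0" if y: "y \<in> hyp_space n" "hyp_dist n x y < \<epsilon>" for y
  proof (rule ccontr)
    assume contra: "\<not> lorentz n y g < 0"
    define c where "c = - lorentz n x y"
    have c: "1 \<le> c" "c < cosh \<epsilon>"
      using hyp_space_lorentz_le[OF x y(1)] hyp_dist_less_iff[OF x y(1) eps(1)] y(2)
      by (auto simp: c_def)
    have xx: "lorentz n x x = -1" "x \<in> minkowski_space n" "lorentz n y y = -1" "y \<in> minkowski_space n"
      using x y by (auto simp: hyp_space_def)
    define w where "w = lin_comb 1 y (-c) x"
    define h where "h = lin_comb 1 g (-a) x"
    have w: "w \<in> minkowski_space n" "lorentz n x w = 0" "lorentz n w w = c\<^sup>2 - 1"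
      using xx by (auto simp: w_def c_def power2_eq_square algebra_simps lorentz_sym[of n y x])
    have h: "h \<in> minkowski_space n" "lorentz n x h = 0" "lorentz n h h = K"
      using xx g by (auto simp: h_def a_def K_def power2_eq_square algebra_simps lorentz_sym[of n g x])
    have wh: "lorentz n w h = lorentz n y g + c * a"
      using xx by (auto simp: h_def a_def w_def c_def algebra_simps lorentz_sym[of n y x])
    have "K \<ge> 0"
      using h timelike_orth_Cauchy_Schwarz[of n x h h] timelike_orth_spacelike[of n x h] xx
      by (cases "h = (\<lambda>_. 0)") (auto simp: lorentz_def)
    have "a > 0" using g by (simp add: a_def)
    then have "1 * a \<le> c * a"
      using c by (intro mult_right_mono) auto
    then have "a \<le> lorentz n w h"
      using contra wh by linarith
    then have "a\<^sup>2 \<le> (lorentz n w h)\<^sup>2"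
      using \<open>a > 0\<close> by (intro power_mono) auto
    also have "\<dots> \<le> (c\<^sup>2 - 1) * K"
      using timelike_orth_Cauchy_Schwarz[of n x w h] w h xx by simp
    also have "\<dots> \<le> ((cosh \<epsilon>)\<^sup>2 - 1) * K"
      using c \<open>K \<ge> 0\<close> by (intro mult_right_mono diff_right_mono power_mono) auto
    finally show False using eps by simp
  qed
  then show ?thesis using eps(1) by blast
qed

lemma finite_lorentz_neg_near:
  assumes x: "x \<in> hyp_space n" and "finite G" and g: "\<And>g. g \<in> G \<Longrightarrow> g \<in> minkowski_space n \<and> lorentz n x g < 0"
  shows "\<exists>\<epsilon>>0. \<forall>y\<in>hyp_space n. hyp_dist n x y < \<epsilon> \<longrightarrow> (\<forall>g\<in>G. lorentz n y g < 0)"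
  using assms(2) g
proof (induction G rule: finite_induct)
  case empty
  then show ?case by (auto intro: exI[of _ 1])
next
  case (insert h G)
  obtain \<epsilon> where e: "\<epsilon> > 0" "\<forall>y\<in>hyp_space n. hyp_dist n x y < \<epsilon> \<longrightarrow> (\<forall>g\<in>G. lorentz n y g < 0)"
    using insert by blast
  obtain \<delta> where d: "\<delta> > 0" "\<forall>y\<in>hyp_space n. hyp_dist n x y < \<delta> \<longrightarrow> lorentz n y h < 0"
    using lorentz_neg_near[OF x] insert.prems[of h] by blast
  show ?case
    using e d by (intro exI[of _ "min \<epsilon> \<delta>"]) auto
qed

section \<open>Facets of hyperbolic polytopes\<close>

lemma unit_normals_unit: "e \<in> unit_normals n \<Longrightarrow> lorentz n e e = 1"
  by (simp add: unit_normals_def)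

lemma unit_normals_proportional:
  assumes "e \<in> unit_normals n" "g \<in> unit_normals n" "lin_comb 1 g c e = (\<lambda>_. 0)"
  shows "g = e \<or> g = lin_comb (-1) e 0 e"
proof -
  have g: "g i = - c * e i" for i
    using fun_cong[OF assms(3), of i] by (simp add: lin_comb_def)
  then have "g = lin_comb (-c) e 0 e"
    by (simp add: lin_comb_def fun_eq_iff)
  then have "1 = c * c"
    using assms(1,2) by (simp add: unit_normals_def)
  then have "c = 1 \<or> c = -1"
    by (metis mult_cancel_left1 square_eq_1_iff)
  then show ?thesis
    using g by (auto simp: lin_comb_def fun_eq_iff)
qed

text \<open>
  Relative interior points are used only through this consequence: one can move a little from them in every
  direction of the hyperplane. It spares the later arguments the metric.
\<close>

lemma interior_hyperplane_witness:
  assumes "nonempty_interior_in n (hyp_hyperplane n e) (hyp_hyperplane n e \<inter> P)"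
  shows "\<exists>p\<in>hyp_space n. p \<in> P \<and> lorentz n p e = 0 \<and>
    (\<forall>v\<in>minkowski_space n. lorentz n v e = 0 \<longrightarrow>
      (\<forall>\<^sub>F t in at_right 0. t > 0 \<and> lin_comb 1 p t v \<in> future_cone n \<and> normalise n (lin_comb 1 p t v) \<in> P))"
proof -
  obtain p \<epsilon> where p: "p \<in> hyp_hyperplane n e" "p \<in> P" "\<epsilon> > 0"
      "\<And>y. y \<in> hyp_hyperplane n e \<Longrightarrow> hyp_dist n p y < \<epsilon> \<Longrightarrow> y \<in> P"
    using assms unfolding nonempty_interior_in_def by blast
  then have pe: "p \<in> hyp_space n" "lorentz n p e = 0" by (auto simp: hyp_hyperplane_def)
  show ?thesis
  proof (intro bexI conjI ballI impI)
    fix v assume v: "v \<in> minkowski_space n" "lorentz n v e = 0"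
    have "\<forall>\<^sub>F t in at_right 0. hyp_dist n p (normalise n (lin_comb 1 p t v)) < \<epsilon>"
      using eventually_hyp_dist_less[OF pe(1) v(1) p(3)] .
    moreover have "\<forall>\<^sub>F t in at_right 0. lin_comb 1 p t v \<in> future_cone n"
      using eventually_lin_comb_future_cone[OF hyp_space_future_cone[OF pe(1)] v(1)] .
    moreover have "\<forall>\<^sub>F t in at_right (0::real). t > 0"
      by (simp add: eventually_at_right_less)
    ultimately show "\<forall>\<^sub>F t in at_right 0. t > 0 \<and> lin_comb 1 p t v \<in> future_cone n \<and> normalise n (lin_comb 1 p t v) \<in> P"
    proof eventually_elim
      case (elim t)
      then show ?case
        using p(4)[of "normalise n (lin_comb 1 p t v)"] normalise_hyp_space[OF elim(2)]
          lorentz_normalise_iff(2)[OF elim(2), of e] pe v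
        by (auto simp: hyp_hyperplane_def)
    qed
  qed (use p pe in auto)
qed

lemma interior_lorentz_neg:
  assumes int: "nonempty_interior_in n (hyp_space n) P" "P \<subseteq> hyp_space n"
  shows "\<exists>z\<in>hyp_space n. \<forall>g\<in>unit_normals n. P \<subseteq> hyp_halfspace n g \<longrightarrow> lorentz n z g < 0"
proof -
  \<comment> \<open>Hyperbolic space itself is the hyperplane of the zero vector.\<close>
  have whole: "hyp_hyperplane n (\<lambda>_. 0) = hyp_space n" "\<And>v. lorentz n v (\<lambda>_. 0) = 0"
    by (simp_all add: hyp_hyperplane_def lorentz_def)
  have "nonempty_interior_in n (hyp_hyperplane n (\<lambda>_. 0)) (hyp_hyperplane n (\<lambda>_. 0) \<inter> P)"
    using int by (simp add: whole Int_absorb1)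
  from interior_hyperplane_witness[OF this]
  obtain z where z: "z \<in> hyp_space n" "z \<in> P"
    "\<forall>v\<in>minkowski_space n. \<forall>\<^sub>F t in at_right 0. t > 0 \<and> lin_comb 1 z t v \<in> future_cone n \<and> normalise n (lin_comb 1 z t v) \<in> P"
    by (auto simp: whole)
  have "lorentz n z g < 0" if g: "g \<in> unit_normals n" "P \<subseteq> hyp_halfspace n g" for g
  proof (rule ccontr)
    assume "\<not> lorentz n z g < 0"
    moreover have "lorentz n z g \<le> 0"
      using g z by (auto simp: hyp_halfspace_def)
    ultimately have 0: "lorentz n z g = 0" by simp
    from z(3) unit_normals_minkowski[OF g(1)]
    have "\<forall>\<^sub>F t in at_right 0. t > 0 \<and> lin_comb 1 z t g \<in> future_cone n \<and> normalise n (lin_comb 1 z t g) \<in> P"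
      by blast
    then obtain t where t: "t > 0" "lin_comb 1 z t g \<in> future_cone n" "normalise n (lin_comb 1 z t g) \<in> P"
      using eventually_happens'[OF trivial_limit_at_right_real] by blast
    then have "lorentz n (lin_comb 1 z t g) g \<le> 0"
      using g(2) lorentz_normalise_iff(1)[OF t(2), of g] by (auto simp: hyp_halfspace_def)
    then show False
      using 0 t(1) unit_normals_unit[OF g(1)] by simp
  qed
  with z(1) show ?thesis by blast
qed

locale polytope =
  fixes n P
  assumes P: "hyp_polytope n P"
begin

lemma polytope_subset: "P \<subseteq> hyp_space n"
  using P by (auto simp: hyp_polytope_def)

lemma polytope_interior: "nonempty_interior_in n (hyp_space n) P"
  using P by (auto simp: hyp_polytope_def)

lemma facet_unit: "e \<in> facet_normals n P \<Longrightarrow> e \<in> unit_normals n"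
  and facet_halfspace: "e \<in> facet_normals n P \<Longrightarrow> P \<subseteq> hyp_halfspace n e"
  by (auto simp: facet_normals_def)

lemma opposite_not_supporting:
  assumes "e \<in> unit_normals n" "P \<subseteq> hyp_halfspace n e"
    and "lin_comb (-1) e 0 e \<in> unit_normals n" "P \<subseteq> hyp_halfspace n (lin_comb (-1) e 0 e)"
  shows False
proof -
  obtain z where "\<forall>g\<in>unit_normals n. P \<subseteq> hyp_halfspace n g \<longrightarrow> lorentz n z g < 0"
    using interior_lorentz_neg[OF polytope_interior polytope_subset] by blast
  with assms have "lorentz n z e < 0" "lorentz n z (lin_comb (-1) e 0 e) < 0"
    by blast+
  then show False by simp
qed

text \<open>
  A relatively interior point \<open>p\<close> of the facet with normal \<open>e\<close> lies strictly inside
  every other supporting half-space: if \<open>p\<close> were on the hyperplane of \<open>g\<close>, then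
  moving \<open>p\<close> along the component of \<open>g\<close> orthogonal to \<open>e\<close> would keep it
  on the hyperplane of \<open>e\<close>, hence in \<open>P\<close>, but leave the half-space of
  \<open>g\<close>. The component vanishes only for \<open>g = -e\<close>, which would flatten
  \<open>P\<close>.
\<close>

lemma facet_point:
  assumes e: "e \<in> facet_normals n P"
  shows "\<exists>p\<in>hyp_space n. lorentz n p e = 0 \<and>
    (\<forall>g\<in>unit_normals n. P \<subseteq> hyp_halfspace n g \<longrightarrow> g \<noteq> e \<longrightarrow> lorentz n p g < 0)"
proof -
  have "nonempty_interior_in n (hyp_hyperplane n e) (hyp_hyperplane n e \<inter> P)"
    using e by (simp add: facet_normals_def)
  from interior_hyperplane_witness[OF this]
  obtain p where p: "p \<in> hyp_space n" "p \<in> P" "lorentz n p e = 0"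
    "\<forall>v\<in>minkowski_space n. lorentz n v e = 0 \<longrightarrow>
      (\<forall>\<^sub>F t in at_right 0. t > 0 \<and> lin_comb 1 p t v \<in> future_cone n \<and> normalise n (lin_comb 1 p t v) \<in> P)"
    by blast
  have eu: "e \<in> unit_normals n" "lorentz n e e = 1" "e \<in> minkowski_space n"
    using facet_unit[OF e] by (auto simp: unit_normals_def)
  have "lorentz n p g < 0" if g: "g \<in> unit_normals n" "P \<subseteq> hyp_halfspace n g" "g \<noteq> e" for g
  proof (rule ccontr)
    assume "\<not> lorentz n p g < 0"
    moreover have "lorentz n p g \<le> 0"
      using g p by (auto simp: hyp_halfspace_def)
    ultimately have 0: "lorentz n p g = 0" by simp
    have gu: "lorentz n g g = 1" "g \<in> minkowski_space n"
      using g by (auto simp: unit_normals_def)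
    define v where "v = lin_comb 1 g (- lorentz n g e) e"
    have v: "v \<in> minkowski_space n" "lorentz n v e = 0" "lorentz n p v = 0" "lorentz n v g = lorentz n v v"
      using gu eu 0 p by (auto simp: v_def algebra_simps lorentz_sym[of n e g])
    have "v \<noteq> (\<lambda>_. 0)"
    proof
      assume "v = (\<lambda>_. 0)"
      then have "g = lin_comb (-1) e 0 e"
        using unit_normals_proportional[OF eu(1) g(1)] g(3) by (auto simp: v_def)
      then show False
        using opposite_not_supporting[OF eu(1) facet_halfspace[OF e]] g by simp
    qed
    then have vv: "lorentz n v v > 0"
      using timelike_orth_spacelike[of n p v] v p by (simp add: hyp_space_def)
    from p(4) v(1,2)
    have "\<forall>\<^sub>F t in at_right 0. t > 0 \<and> lin_comb 1 p t v \<in> future_cone n \<and> normalise n (lin_comb 1 p t v) \<in> P"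
      by blast
    then obtain t where t: "t > 0" "lin_comb 1 p t v \<in> future_cone n" "normalise n (lin_comb 1 p t v) \<in> P"
      using eventually_happens'[OF trivial_limit_at_right_real] by blast
    then have "lorentz n (lin_comb 1 p t v) g \<le> 0"
      using g(2) lorentz_normalise_iff(1)[OF t(2), of g] by (auto simp: hyp_halfspace_def)
    then have "t * lorentz n v v \<le> 0"
      using 0 v by simp
    then show False
      using t(1) vv by (simp add: mult_le_0_iff)
  qed
  with p(1,3) show ?thesis by blast
qed

lemma facet_point_strict:
  assumes "e \<in> facet_normals n P"
  shows "\<exists>p\<in>hyp_space n. lorentz n p e = 0 \<and> (\<forall>g\<in>facet_normals n P - {e}. lorentz n p g < 0)"
  using facet_point[OF assms] facet_unit facet_halfspace by blast

text \<open>
  A minimal family of half-spaces defining \<open>P\<close> consists of facets. If \<open>e\<close> cannot be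
  dropped, some \<open>y\<close> satisfies all other constraints but violates \<open>e\<close>; the segment
  from \<open>y\<close> to an interior point of \<open>P\<close> crosses the hyperplane of \<open>e\<close> at
  a point strictly inside all the others.
\<close>

lemma halfspaces_from_facets:
  obtains E where "finite E" "E \<subseteq> facet_normals n P" "P = hyp_space n \<inter> (\<Inter>e\<in>E. hyp_halfspace n e)"
proof -
  define Q where "Q = (\<lambda>E. finite E \<and> E \<subseteq> unit_normals n \<and> P = hyp_space n \<inter> (\<Inter>e\<in>E. hyp_halfspace n e))"
  have "\<exists>E. Q E" using P unfolding hyp_polytope_def Q_def by blast
  then obtain E where E: "Q E" "\<And>E'. Q E' \<Longrightarrow> card E \<le> card E'"
    using arg_min_nat_lemma[of Q _ card] by blast
  then have fin: "finite E" and EU: "E \<subseteq> unit_normals n" and PE: "P = hyp_space n \<inter> (\<Inter>e\<in>E. hyp_halfspace n e)"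
    by (auto simp: Q_def)
  obtain z where z: "z \<in> hyp_space n" "\<forall>g\<in>unit_normals n. P \<subseteq> hyp_halfspace n g \<longrightarrow> lorentz n z g < 0"
    using interior_lorentz_neg[OF polytope_interior polytope_subset] by blast
  have "e \<in> facet_normals n P" if e: "e \<in> E" for e
  proof -
    have "card (E - {e}) < card E" using fin e by (rule card_Diff1_less)
    then have "\<not> Q (E - {e})" using E(2)[of "E - {e}"] by linarith
    then have "P \<noteq> hyp_space n \<inter> (\<Inter>e\<in>E-{e}. hyp_halfspace n e)"
      using fin EU by (auto simp: Q_def)
    then obtain y where y: "y \<in> hyp_space n" "\<And>g. g \<in> E - {e} \<Longrightarrow> y \<in> hyp_halfspace n g" "y \<notin> P"
      using PE by auto
    then have "y \<notin> hyp_halfspace n e" using PE by auto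
    then have ye: "lorentz n y e > 0" using y(1) by (auto simp: hyp_halfspace_def)
    have Pe: "P \<subseteq> hyp_halfspace n g" if "g \<in> E" for g using PE that by auto
    have zg: "lorentz n z g < 0" if "g \<in> E" for g using z(2) Pe[OF that] that EU by blast
    \<comment> \<open>The weights are chosen to make \<open>q\<close> orthogonal to \<open>e\<close>; both are positive.\<close>
    define q where "q = lin_comb (lorentz n y e) z (- lorentz n z e) y"
    have qf: "q \<in> future_cone n"
      unfolding q_def using ye zg[OF e] z y
      by (intro future_cone_lin_comb hyp_space_future_cone) auto
    have qe: "lorentz n q e = 0" by (simp add: q_def)
    have qg: "lorentz n q g < 0" if "g \<in> E - {e}" for g
    proof -
      have "lorentz n y g \<le> 0" using y(2)[OF that] by (simp add: hyp_halfspace_def)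
      then have "- lorentz n z e * lorentz n y g \<le> 0"
        using zg[OF e] by (simp add: mult_le_0_iff mult_nonpos_nonpos zero_le_mult_iff)
      moreover have "lorentz n y e * lorentz n z g < 0"
        using ye zg that by (simp add: mult_pos_neg)
      ultimately show ?thesis by (simp add: q_def)
    qed
    define p where "p = normalise n q"
    have p: "p \<in> hyp_space n" "lorentz n p e = 0" "\<And>g. g \<in> E - {e} \<Longrightarrow> lorentz n p g < 0"
      using normalise_hyp_space[OF qf] lorentz_normalise_iff[OF qf] qe qg by (auto simp: p_def)
    obtain \<epsilon> where eps: "\<epsilon> > 0" "\<And>y. y \<in> hyp_space n \<Longrightarrow> hyp_dist n p y < \<epsilon> \<Longrightarrow> (\<forall>g\<in>E-{e}. lorentz n y g < 0)"
      using finite_lorentz_neg_near[OF p(1), of "E - {e}"] p(3) fin EU unit_normals_minkowski by blast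
    have inP: "x \<in> P" if "x \<in> hyp_space n" "lorentz n x e = 0" "\<forall>g\<in>E-{e}. lorentz n x g < 0" for x
      unfolding PE using that by (force simp: hyp_halfspace_def)
    have "nonempty_interior_in n (hyp_hyperplane n e) (hyp_hyperplane n e \<inter> P)"
      unfolding nonempty_interior_in_def
    proof (intro bexI exI conjI ballI impI)
      show "p \<in> hyp_hyperplane n e \<inter> P"
        using p inP by (auto simp: hyp_hyperplane_def)
    qed (use eps inP in \<open>auto simp: hyp_hyperplane_def\<close>)
    then show ?thesis
      using Pe e EU by (auto simp: facet_normals_def)
  qed
  with fin PE that show ?thesis by blast
qed

text \<open>
  For a product of at least 1 one half-space would contain the other. Formally, \<open>e - f\<close> would not
  be spacelike, yet it is orthogonal to a suitable point between a point of the facet of \<open>e\<close> and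
  one of the facet of \<open>f\<close>, because it takes opposite signs there.
\<close>

lemma facet_lorentz_less_1:
  assumes e: "e \<in> facet_normals n P" and f: "f \<in> facet_normals n P" and "e \<noteq> f"
  shows "lorentz n e f < 1"
proof -
  obtain p where p: "p \<in> hyp_space n" "lorentz n p e = 0" "lorentz n p f < 0"
    using facet_point_strict[OF e] f \<open>e \<noteq> f\<close> by blast
  obtain q where q: "q \<in> hyp_space n" "lorentz n q f = 0" "lorentz n q e < 0"
    using facet_point_strict[OF f] e \<open>e \<noteq> f\<close> by blast
  define v where "v = lin_comb 1 e (-1) f"
  define z where "z = lin_comb (- lorentz n q e) p (- lorentz n p f) q"
  have "z \<in> future_cone n"
    unfolding z_def using p q by (intro future_cone_lin_comb hyp_space_future_cone) auto
  moreover have "lorentz n z v = 0"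
    using p q by (simp add: z_def v_def)
  moreover have "v \<in> minkowski_space n"
    using e f facet_unit unit_normals_minkowski by (simp add: v_def)
  moreover have "v \<noteq> (\<lambda>_. 0)"
    using \<open>e \<noteq> f\<close> by (auto simp: v_def lin_comb_def fun_eq_iff)
  ultimately have "lorentz n v v > 0"
    by (intro timelike_orth_spacelike[of n z]) (auto simp: future_cone_def)
  moreover have "lorentz n v v = 2 - 2 * lorentz n e f"
    using unit_normals_unit[OF facet_unit[OF e]] unit_normals_unit[OF facet_unit[OF f]]
    by (simp add: v_def lorentz_sym[of n f e])
  ultimately show ?thesis by simp
qed

section \<open>Adjacent facets\<close>

text \<open>
  Points of a facet can be chosen off finitely many hyperplanes that do not contain the facet. If
  \<open>p\<close> lies on the hyperplane of \<open>m\<close>, moving along the component of \<open>m\<close>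
  orthogonal to \<open>e\<close> leaves it, because that component is orthogonal to \<open>p\<close> and hence
  spacelike.
\<close>

lemma generic_facet_point:
  assumes e: "e \<in> facet_normals n P" and fin: "finite (facet_normals n P)"
    and "finite N" and N: "\<And>m. m \<in> N \<Longrightarrow> m \<in> minkowski_space n \<and> (\<forall>b. m \<noteq> lin_comb b e 0 e)"
  shows "\<exists>p\<in>future_cone n. lorentz n p e = 0 \<and> (\<forall>g\<in>facet_normals n P - {e}. lorentz n p g < 0) \<and>
      (\<forall>m\<in>N. lorentz n p m \<noteq> 0)"
  using assms(3) N
proof (induction N rule: finite_induct)
  case empty
  then show ?case
    using facet_point_strict[OF e] hyp_space_future_cone by blast
next
  case (insert m N)
  obtain p where p: "p \<in> future_cone n" "lorentz n p e = 0"
      "\<forall>g\<in>facet_normals n P - {e}. lorentz n p g < 0" "\<forall>m\<in>N. lorentz n p m \<noteq> 0"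
    using insert by blast
  show ?case
  proof (cases "lorentz n p m = 0")
    case False
    then show ?thesis using p by blast
  next
    case True
    have eu: "lorentz n e e = 1" "e \<in> minkowski_space n"
      using facet_unit[OF e] by (auto simp: unit_normals_def)
    have m: "m \<in> minkowski_space n" "\<And>b. m \<noteq> lin_comb b e 0 e" using insert.prems by auto
    define v where "v = lin_comb 1 m (- lorentz n m e) e"
    have v: "v \<in> minkowski_space n" "lorentz n v e = 0" "lorentz n p v = 0" "lorentz n v m = lorentz n v v"
      using eu m p True by (auto simp: v_def algebra_simps lorentz_sym[of n e m])
    have "v \<noteq> (\<lambda>_. 0)"
    proof
      assume "v = (\<lambda>_. 0)"
      then have "m = lin_comb (lorentz n m e) e 0 e"
        by (simp add: v_def lin_comb_def fun_eq_iff)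
      then show False using m(2) by blast
    qed
    then have vv: "lorentz n v v > 0"
      using timelike_orth_spacelike[of n p v] v p by (simp add: future_cone_def)
    have "\<forall>\<^sub>F t in at_right 0. lin_comb 1 p t v \<in> future_cone n"
      using eventually_lin_comb_future_cone[OF p(1) v(1)] .
    moreover have "\<forall>\<^sub>F t in at_right 0. \<forall>g\<in>facet_normals n P - {e}. lorentz n (lin_comb 1 p t v) g < 0"
      using fin p by (intro eventually_ball_finite ballI eventually_lorentz_neg) auto
    moreover have "\<forall>\<^sub>F t in at_right 0. \<forall>m\<in>N. lorentz n (lin_comb 1 p t v) m \<noteq> 0"
      using insert.hyps p by (intro eventually_ball_finite ballI eventually_lorentz_nonzero) auto
    moreover have "\<forall>\<^sub>F t in at_right (0::real). t > 0"
      by (simp add: eventually_at_right_less)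
    ultimately have "\<forall>\<^sub>F t in at_right 0. t > 0 \<and> lin_comb 1 p t v \<in> future_cone n \<and>
       (\<forall>g\<in>facet_normals n P - {e}. lorentz n (lin_comb 1 p t v) g < 0) \<and> 
       (\<forall>m\<in>N. lorentz n (lin_comb 1 p t v) m \<noteq> 0)"
      by eventually_elim blast
    then obtain t where t: "t > 0" "lin_comb 1 p t v \<in> future_cone n"
       "\<forall>g\<in>facet_normals n P - {e}. lorentz n (lin_comb 1 p t v) g < 0"
       "\<forall>m\<in>N. lorentz n (lin_comb 1 p t v) m \<noteq> 0"
      using eventually_happens'[OF trivial_limit_at_right_real] by blast
    moreover have "lorentz n (lin_comb 1 p t v) m \<noteq> 0"
      using t(1) v vv True by simp
    moreover have "lorentz n (lin_comb 1 p t v) e = 0"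
      using p v by simp
    ultimately show ?thesis by blast
  qed
qed

text \<open>
  If the hyperplanes of the facets \<open>e\<close> and \<open>f\<close> cross, then \<open>e\<close> is
  adjacent to some facet \<open>g\<close>, possibly different from \<open>f\<close>, found on the way to
  \<open>f\<close>. Starting at a point \<open>p\<close> of the facet \<open>e\<close>, walk inside its
  hyperplane in the direction \<open>d = f - \<langle>e, f\<rangle> e\<close>. The hyperplane of
  \<open>f\<close> is reached before the path leaves the future cone, so the path leaves \<open>P\<close>
  there at the latest, through a facet \<open>g\<close> with \<open>\<langle>d, g\<rangle> > 0\<close>. For
  generic \<open>p\<close> no two facets are hit at the same time, so a neighbourhood of the exit point in the
  intersection of the hyperplanes of \<open>e\<close> and \<open>g\<close> belongs to \<open>P\<close>. The
  inequality \<open>\<langle>d, g\<rangle> > 0\<close> is exported because it excludes every \<open>g\<close>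
  orthogonal to both \<open>e\<close> and \<open>f\<close>.
\<close>

lemma adjacent_facet_exists:
  assumes fin: "finite (facet_normals n P)"
    and e: "e \<in> facet_normals n P" and f: "f \<in> facet_normals n P" and ef: "e \<noteq> f"
    and c1: "\<bar>lorentz n e f\<bar> < 1"
  obtains g where "g \<in> facet_normals n P" "g \<noteq> e"
    "lorentz n (lin_comb 1 f (- lorentz n e f) e) g > 0"
    "has_dihedral_angle n P e g (arccos (- lorentz n e g))" "\<bar>lorentz n e g\<bar> < 1"
proof -
  let ?F = "facet_normals n P"
  define d where "d = lin_comb 1 f (- lorentz n e f) e"
  have eu: "lorentz n e e = 1" "e \<in> minkowski_space n" and fu: "lorentz n f f = 1" "f \<in> minkowski_space n"
    using facet_unit[OF e] facet_unit[OF f] by (auto simp: unit_normals_def)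
  have d: "d \<in> minkowski_space n" "lorentz n d e = 0" "lorentz n d f = 1 - (lorentz n e f)\<^sup>2"
      "lorentz n d d = 1 - (lorentz n e f)\<^sup>2"
    using eu fu by (auto simp: d_def power2_eq_square algebra_simps lorentz_sym[of n f e])
  have df: "lorentz n d f > 0"
    using c1 d by (simp add: abs_square_less_1)
  \<comment> \<open>Only these facets are approached along \<open>d\<close>.\<close>
  define H where "H = {g \<in> ?F. lorentz n d g > 0}"
  have fH: "f \<in> H" using f df by (simp add: H_def)
  have He: "e \<notin> H" using d by (simp add: H_def)
  have finH: "finite H" using fin by (simp add: H_def)
  \<comment> \<open>The walk hits \<open>g\<close> and \<open>h\<close> at the same time iff its start is orthogonal to their vector in \<open>N\<close>.\<close>
  define N where "N = (\<lambda>(g, h). lin_comb (lorentz n d h) g (- lorentz n d g) h) ` {(g, h) \<in> H \<times> H. g \<noteq> h}"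
  have "finite N"
  proof -
    have "{(g, h) \<in> H \<times> H. g \<noteq> h} \<subseteq> H \<times> H" by auto
    from finite_subset[OF this] show ?thesis
      unfolding N_def using finH by (intro finite_imageI) simp
  qed
  \<comment> \<open>Such a relation would make the constraint of \<open>g\<close> a consequence of those of \<open>h\<close> and \<open>e\<close>.\<close>
  have bpos: False if gh: "g \<in> H" "h \<in> H" "g \<noteq> h" and b: "b \<ge> 0"
      and eq: "lin_comb (lorentz n d h) g (- lorentz n d g) h = lin_comb b e 0 e" for g h b
  proof -
    have gF: "g \<in> ?F" "h \<in> ?F" "g \<noteq> e" using gh He by (auto simp: H_def)
    obtain q where q: "lorentz n q g = 0" "lorentz n q h < 0" "lorentz n q e < 0"
      using facet_point_strict[OF gF(1)] gF gh(3) e by blast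
    have "lorentz n q (lin_comb (lorentz n d h) g (- lorentz n d g) h) = lorentz n q (lin_comb b e 0 e)"
      by (simp only: eq)
    then have "- lorentz n d g * lorentz n q h = b * lorentz n q e"
      using q by simp
    moreover have "- lorentz n d g * lorentz n q h > 0"
      using gh q by (simp add: H_def mult_pos_neg)
    moreover have "b * lorentz n q e \<le> 0"
      using b q by (simp add: mult_le_0_iff)
    ultimately show False by linarith
  qed
  have "m \<in> minkowski_space n \<and> (\<forall>b. m \<noteq> lin_comb b e 0 e)" if m: "m \<in> N" for m
  proof -
    obtain g h where gh: "g \<in> H" "h \<in> H" "g \<noteq> h" and m: "m = lin_comb (lorentz n d h) g (- lorentz n d g) h"
      using m unfolding N_def by (elim imageE) auto
    have "m \<in> minkowski_space n"
      unfolding m using gh facet_unit unit_normals_minkowski by (auto simp: H_def)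
    moreover have "m \<noteq> lin_comb b e 0 e" for b
    proof
      assume mb: "m = lin_comb b e 0 e"
      show False
      proof (cases "b \<ge> 0")
        case True
        show ?thesis by (rule bpos[OF gh True]) (use mb m in simp)
      next
        case False
        have "lin_comb (lorentz n d g) h (- lorentz n d h) g = lin_comb (-b) e 0 e"
          using mb unfolding m by (auto simp: lin_comb_def fun_eq_iff algebra_simps)
        from bpos[OF gh(2,1) _ _ this] show ?thesis using gh(3) False by auto
      qed
    qed
    ultimately show ?thesis by blast
  qed
  from generic_facet_point[OF e fin \<open>finite N\<close> this]
  obtain p where p: "p \<in> future_cone n" "lorentz n p e = 0"
      "\<forall>g\<in>?F - {e}. lorentz n p g < 0" "\<forall>m\<in>N. lorentz n p m \<noteq> 0"
    by blast
  have pneg: "lorentz n p g < 0" if "g \<in> ?F" "g \<noteq> e" for g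
    using p(3) that by blast
  \<comment> \<open>The time at which the walk reaches the hyperplane of \<open>g\<close>.\<close>
  define T where "T = (\<lambda>g. - lorentz n p g / lorentz n d g)"
  have injT: "T g \<noteq> T h" if gh: "g \<in> H" "h \<in> H" "g \<noteq> h" for g h
  proof
    assume "T g = T h"
    then have "lorentz n p (lin_comb (lorentz n d h) g (- lorentz n d g) h) = 0"
      using gh by (simp add: T_def H_def field_simps)
    moreover have "lin_comb (lorentz n d h) g (- lorentz n d g) h \<in> N"
      unfolding N_def using gh by force
    ultimately show False using p(4) by blast
  qed
  have "Min (T ` H) \<in> T ` H"
    using finH fH by (intro Min_in) auto
  then obtain g where g: "g \<in> H" "T g = Min (T ` H)"
    by auto
  have gmin: "T g \<le> T h" if "h \<in> H" for h
    unfolding g(2) using finH that by (intro Min_le) auto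
  have gF: "g \<in> ?F" "g \<noteq> e" and gu: "lorentz n g g = 1" "g \<in> minkowski_space n"
    using g(1) He facet_unit by (auto simp: H_def unit_normals_def)
  have T0: "T g > 0"
    using g(1) pneg[OF gF] by (simp add: T_def H_def divide_neg_pos)
  define x where "x = lin_comb 1 p (T g) d"
  have xe: "lorentz n x e = 0" using p d by (simp add: x_def)
  have xg: "lorentz n x g = 0" using g(1) by (simp add: x_def T_def H_def)
  have xh: "lorentz n x h < 0" if h: "h \<in> ?F" "h \<noteq> e" "h \<noteq> g" for h
  proof (cases "h \<in> H")
    case True
    then have "T g < T h" using gmin[OF True] injT[OF g(1) True] h by force
    then have "T g * lorentz n d h < T h * lorentz n d h"
      using True by (intro mult_strict_right_mono) (auto simp: H_def)
    also have "T h * lorentz n d h = - lorentz n p h"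
      using True by (simp add: T_def H_def)
    finally show ?thesis
      by (simp add: x_def)
  next
    case False
    then have "T g * lorentz n d h \<le> 0" using h T0 by (simp add: H_def mult_le_0_iff)
    then show ?thesis using pneg[OF h(1,2)] by (simp add: x_def)
  qed
  have pd: "lorentz n p d = lorentz n p f" "lorentz n p f < 0"
    using p(2) pneg[OF f] ef by (auto simp: d_def)
  \<comment> \<open>Up to the time \<open>T f\<close> the norm along the path does not exceed its value at \<open>p\<close>.\<close>
  have "T g * lorentz n d d \<le> T f * lorentz n d d"
    using gmin[OF fH] df d by (intro mult_right_mono) auto
  then have Tdd: "T g * lorentz n d d \<le> - lorentz n p f"
    using df d by (simp add: T_def)
  have "lorentz n x x = lorentz n p p + T g * (2 * lorentz n p d + T g * lorentz n d d)"
    by (simp add: x_def algebra_simps lorentz_sym[of n d p])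
  also have "T g * (2 * lorentz n p d + T g * lorentz n d d) \<le> 0"
    using T0 Tdd pd by (simp add: mult_le_0_iff)
  finally have xx: "lorentz n x x < 0"
    using p(1) by (simp add: future_cone_def)
  have xM: "x \<in> minkowski_space n" using future_cone_minkowski[OF p(1)] d by (simp add: x_def)
  have "T g * lorentz n p d < 0"
    using T0 pd by (simp add: mult_pos_neg)
  moreover have "lorentz n p p < 0"
    using p(1) by (simp add: future_cone_def)
  ultimately have "lorentz n p x \<le> 0"
    by (simp add: x_def)
  with xx xM have xf: "x \<in> future_cone n" using future_coneI[OF p(1)] by blast
  define y where "y = normalise n x"
  have y: "y \<in> hyp_space n" "lorentz n y e = 0" "lorentz n y g = 0"
      "\<And>h. h \<in> ?F - {e, g} \<Longrightarrow> lorentz n y h < 0"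
    using normalise_hyp_space[OF xf] lorentz_normalise_iff[OF xf] xe xg xh by (auto simp: y_def)
  have "\<exists>\<epsilon>>0. \<forall>z\<in>hyp_space n. hyp_dist n y z < \<epsilon> \<longrightarrow> (\<forall>h\<in>?F - {e, g}. lorentz n z h < 0)"
  proof (rule finite_lorentz_neg_near[OF y(1)])
    show "finite (?F - {e, g})" using fin by simp
    fix h assume h: "h \<in> ?F - {e, g}"
    then have "h \<in> unit_normals n" using facet_unit by blast
    then show "h \<in> minkowski_space n \<and> lorentz n y h < 0"
      using y(4)[OF h] unit_normals_minkowski by blast
  qed
  then obtain \<epsilon> where eps: "\<epsilon> > 0"
      "\<forall>z\<in>hyp_space n. hyp_dist n y z < \<epsilon> \<longrightarrow> (\<forall>h\<in>?F - {e, g}. lorentz n z h < 0)"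
    by blast
  obtain E where "finite E" and E: "E \<subseteq> ?F" "P = hyp_space n \<inter> (\<Inter>e\<in>E. hyp_halfspace n e)"
    by (rule halfspaces_from_facets)
  have inP: "z \<in> P" if "z \<in> hyp_space n" "lorentz n z e = 0" "lorentz n z g = 0" "\<forall>h\<in>?F - {e, g}. lorentz n z h < 0" for z
  proof -
    have "z \<in> hyp_halfspace n h" if "h \<in> E" for h
    proof -
      have "lorentz n z h \<le> 0"
        using \<open>h \<in> E\<close> E(1) \<open>lorentz n z e = 0\<close> \<open>lorentz n z g = 0\<close>
          \<open>\<forall>h\<in>?F - {e, g}. lorentz n z h < 0\<close> by (cases "h = e"; cases "h = g") force+
      then show ?thesis using \<open>z \<in> hyp_space n\<close> by (simp add: hyp_halfspace_def)
    qed
    then show ?thesis using \<open>z \<in> hyp_space n\<close> by (subst E(2)) blast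
  qed
  have "nonempty_interior_in n (hyp_hyperplane n e \<inter> hyp_hyperplane n g)
        (hyp_hyperplane n e \<inter> hyp_hyperplane n g \<inter> P)"
    unfolding nonempty_interior_in_def
  proof (intro bexI exI conjI ballI impI)
    show "y \<in> hyp_hyperplane n e \<inter> hyp_hyperplane n g \<inter> P"
      using y inP by (auto simp: hyp_hyperplane_def)
  qed (use eps inP in \<open>auto simp: hyp_hyperplane_def\<close>)
  then have angle: "has_dihedral_angle n P e g (arccos (- lorentz n e g))"
    using e gF by (auto simp: has_dihedral_angle_def)
  have "\<bar>lorentz n e g\<bar> < 1"
  proof -
    define v where "v = lin_comb 1 g (- lorentz n e g) e"
    have v: "v \<in> minkowski_space n" "lorentz n x v = 0" "lorentz n v v = 1 - (lorentz n e g)\<^sup>2"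
      using eu gu xe xg by (auto simp: v_def power2_eq_square algebra_simps lorentz_sym[of n g e])
    have "v \<noteq> (\<lambda>_. 0)"
    proof
      assume "v = (\<lambda>_. 0)"
      then have "g = lin_comb (-1) e 0 e"
        using unit_normals_proportional[OF facet_unit[OF e] facet_unit[OF gF(1)]] gF(2) by (auto simp: v_def)
      then show False
        using opposite_not_supporting[OF facet_unit[OF e] facet_halfspace[OF e]] 
          facet_unit[OF gF(1)] facet_halfspace[OF gF(1)] by simp
    qed
    then have "lorentz n v v > 0"
      using timelike_orth_spacelike[OF xx v(1,2)] by simp
    then show ?thesis using v(3) by (simp add: abs_square_less_1)
  qed
  then show thesis
    using that[OF gF(1,2) _ angle] g(1) by (simp add: H_def d_def)
qed

end

section \<open>Products of reflections\<close>

text \<open>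
  Reflections as elements of the isometry group are defined on hyperbolic space only. Their iterates are
  computed with the linear extension, because the computation decomposes points along the normals.
\<close>

definition reflect :: "nat \<Rightarrow> (nat \<Rightarrow> real) \<Rightarrow> (nat \<Rightarrow> real) \<Rightarrow> nat \<Rightarrow> real" where
  "reflect n e x = lin_comb 1 x (- 2 * lorentz n x e) e"

lemma hyp_reflection_eq: "hyp_reflection n e = restrict (reflect n e) (hyp_space n)"
  by (auto simp: hyp_reflection_def reflect_def lin_comb_def fun_eq_iff)

lemma lorentz_reflect:
  assumes "lorentz n e e = 1"
  shows "lorentz n (reflect n e x) (reflect n e y) = lorentz n x y"
  using assms by (simp add: reflect_def algebra_simps lorentz_sym[of n e x] lorentz_sym[of n e y])

lemma reflect_reflect:
  assumes "lorentz n e e = 1"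
  shows "reflect n e (reflect n e x) = x"
  using assms by (simp add: reflect_def fun_eq_iff) (simp add: lin_comb_def algebra_simps)

lemma reflect_hyp_space:
  assumes "e \<in> unit_normals n" "x \<in> hyp_space n"
  shows "reflect n e x \<in> hyp_space n"
proof -
  have e: "lorentz n e e = 1" "e \<in> minkowski_space n" and x: "lorentz n x x = -1" "x \<in> minkowski_space n"
    using assms by (auto simp: unit_normals_def hyp_space_def)
  have 1: "lorentz n (reflect n e x) (reflect n e x) = -1"
    using lorentz_reflect[OF e(1)] x by simp
  have "reflect n e x \<in> minkowski_space n"
    using e x by (simp add: reflect_def)
  moreover have "lorentz n x (reflect n e x) = -1 - 2 * (lorentz n x e * lorentz n x e)"
    using x by (simp add: reflect_def)
  then have "lorentz n x (reflect n e x) \<le> 0"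
    using zero_le_square[of "lorentz n x e"] by linarith
  ultimately have "reflect n e x \<in> future_cone n"
    using 1 by (intro future_coneI[OF hyp_space_future_cone[OF assms(2)]]) auto
  then show ?thesis
    using 1 by (simp add: hyp_space_def future_cone_def)
qed

lemma subgroup_hyp_isometries: "subgroup (hyp_isometries n) (BijGroup (hyp_space n))"
proof (rule subgroup.intro)
  show "hyp_isometries n \<subseteq> carrier (BijGroup (hyp_space n))"
    by (auto simp: hyp_isometries_def BijGroup_def)
next
  fix f g assume fg: "f \<in> hyp_isometries n" "g \<in> hyp_isometries n"
  then have "f \<in> Bij (hyp_space n)" "g \<in> Bij (hyp_space n)" "g \<in> hyp_space n \<rightarrow> hyp_space n"
    by (auto simp: hyp_isometries_def dest: Bij_imp_funcset)
  with fg show "f \<otimes>\<^bsub>BijGroup (hyp_space n)\<^esub> g \<in> hyp_isometries n"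
    by (auto simp: hyp_isometries_def BijGroup_def compose_Bij compose_eq Pi_iff)
next
  show "\<one>\<^bsub>BijGroup (hyp_space n)\<^esub> \<in> hyp_isometries n"
    by (auto simp: hyp_isometries_def BijGroup_def id_Bij)
next
  fix f assume f: "f \<in> hyp_isometries n"
  then have B: "f \<in> Bij (hyp_space n)" and
    iso: "\<And>x y. x \<in> hyp_space n \<Longrightarrow> y \<in> hyp_space n \<Longrightarrow> hyp_dist n (f x) (f y) = hyp_dist n x y"
    by (auto simp: hyp_isometries_def)
  have im: "f ` hyp_space n = hyp_space n"
    using B by (auto simp: Bij_def bij_betw_def)
  have "hyp_dist n (inv_into (hyp_space n) f x) (inv_into (hyp_space n) f y) = hyp_dist n x y"
    if "x \<in> hyp_space n" "y \<in> hyp_space n" for x y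
    using iso[of "inv_into (hyp_space n) f x" "inv_into (hyp_space n) f y"]
      Bij_inv_into_mem[OF B] that by (simp add: f_inv_into_f im)
  then show "inv\<^bsub>BijGroup (hyp_space n)\<^esub> f \<in> hyp_isometries n"
    by (simp add: inv_BijGroup[OF B] hyp_isometries_def restrict_inv_into_Bij[OF B])
qed

lemma group_Isom_hyp: "group (Isom_hyp n)"
  unfolding Isom_hyp_def
  by (rule subgroup.subgroup_is_group[OF subgroup_hyp_isometries group_BijGroup])

lemma hyp_reflection_isometry:
  assumes "e \<in> unit_normals n"
  shows "hyp_reflection n e \<in> hyp_isometries n"
proof -
  have e: "lorentz n e e = 1" using assms by (simp add: unit_normals_def)
  have "bij_betw (hyp_reflection n e) (hyp_space n) (hyp_space n)"
    by (rule bij_betw_byWitness[where f' = "hyp_reflection n e"])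
      (auto simp: hyp_reflection_eq reflect_hyp_space[OF assms] reflect_reflect[OF e])
  then show ?thesis
    by (auto simp: hyp_isometries_def Bij_def hyp_reflection_eq reflect_hyp_space[OF assms] hyp_dist_def lorentz_reflect[OF e])
qed

lemma group_polytope_group: "group (polytope_group n P)"
  unfolding polytope_group_def using group.group_subgroup_generated[OF group_Isom_hyp] .

lemma polytope_group_carrier_subset: "carrier (polytope_group n P) \<subseteq> hyp_isometries n"
  using group.carrier_subgroup_generated_subset[OF group_Isom_hyp, of n "polytope_reflections n P"]
  by (simp add: polytope_group_def Isom_hyp_def)

lemma polytope_group_mult:
  assumes "f \<in> hyp_isometries n" "g \<in> hyp_isometries n"
  shows "f \<otimes>\<^bsub>polytope_group n P\<^esub> g = compose (hyp_space n) f g"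
  using assms by (simp add: polytope_group_def Isom_hyp_def BijGroup_def hyp_isometries_def)

lemma polytope_group_one: "\<one>\<^bsub>polytope_group n P\<^esub> = (\<lambda>x\<in>hyp_space n. x)"
  by (simp add: polytope_group_def Isom_hyp_def BijGroup_def)

lemma reflection_in_polytope_group:
  assumes "e \<in> facet_normals n P"
  shows "hyp_reflection n e \<in> carrier (polytope_group n P)"
proof -
  have "e \<in> unit_normals n" using assms by (simp add: facet_normals_def)
  then have "hyp_reflection n e \<in> carrier (Isom_hyp n)"
    by (simp add: Isom_hyp_def hyp_reflection_isometry)
  then show ?thesis
    using assms by (auto simp: polytope_group_def carrier_subgroup_generated polytope_reflections_def intro!: generate.incl)
qed

lemma reflection_product_pow:
  assumes e: "e \<in> facet_normals n P" and f: "f \<in> facet_normals n P" and x: "x \<in> hyp_space n"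
  shows "((hyp_reflection n e \<otimes>\<^bsub>polytope_group n P\<^esub> hyp_reflection n f) [^]\<^bsub>polytope_group n P\<^esub> k) x
    = ((reflect n e \<circ> reflect n f) ^^ k) x"
proof -
  let ?G = "polytope_group n P"
  let ?a = "hyp_reflection n e \<otimes>\<^bsub>?G\<^esub> hyp_reflection n f"
  interpret G: group ?G by (rule group_polytope_group)
  have eu: "e \<in> unit_normals n" "f \<in> unit_normals n" using e f by (auto simp: facet_normals_def)
  have ac: "?a \<in> carrier ?G" using e f reflection_in_polytope_group by blast
  then have ai: "?a \<in> hyp_isometries n" using polytope_group_carrier_subset by blast
  have ax: "?a x = reflect n e (reflect n f x)" if "x \<in> hyp_space n" for x
    using that eu
    by (simp add: polytope_group_mult hyp_reflection_isometry compose_eq)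
      (simp add: hyp_reflection_eq reflect_hyp_space)
  show ?thesis
    using x
  proof (induction k arbitrary: x)
    case 0
    then show ?case by (simp add: polytope_group_one)
  next
    case (Suc k)
    have "?a [^]\<^bsub>?G\<^esub> k \<in> carrier ?G" using ac by simp
    then have "?a [^]\<^bsub>?G\<^esub> k \<in> hyp_isometries n" using polytope_group_carrier_subset by blast
    then have "(?a [^]\<^bsub>?G\<^esub> Suc k) x = (?a [^]\<^bsub>?G\<^esub> k) (?a x)"
      using ai Suc.prems by (simp add: polytope_group_mult compose_eq)
    also have "\<dots> = ((reflect n e \<circ> reflect n f) ^^ k) (reflect n e (reflect n f x))"
      using Suc.IH[of "reflect n e (reflect n f x)"] Suc.prems eu
      by (simp only: ax reflect_hyp_space)
    also have "\<dots> = ((reflect n e \<circ> reflect n f) ^^ Suc k) x"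
      by (simp add: funpow_swap1)
    finally show ?case .
  qed
qed

lemma second_order_recurrence:
  fixes x y z w :: real
  assumes "x = c * y - z" "y = c * z - w"
  shows "a * x - b * y = c * (a * y - b * z) - (a * z - b * w)"
proof -
  have "a * x = a * (c * y - z)" "b * y = b * (c * z - w)"
    using assms by (simp_all only:)
  then show ?thesis by (simp add: algebra_simps)
qed

text \<open>
  Two reflections in hyperplanes meeting at the angle \<open>\<theta> = \<pi> / k\<close> compose to a
  rotation by \<open>2 \<theta>\<close>. The vector \<open>x\<close> is split into a fixed part orthogonal to
  \<open>e\<close> and \<open>f\<close> and a part \<open>a e + b f\<close>. As \<open>\<langle>e, f\<rangle>
  = - cos \<theta>\<close>, each reflection acts on the coefficients by the recurrence \<open>sin ((t + 1)
  \<theta>) = 2 cos \<theta> sin (t \<theta>) - sin ((t - 1) \<theta>)\<close>, so the iterates have the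
  closed form \<open>A\<close>, \<open>B\<close> below, which returns to its initial value after
  \<open>k\<close> steps.
\<close>

lemma reflect_product_pow_eq_id:
  assumes e: "lorentz n e e = 1" and f: "lorentz n f f = 1"
    and k: "k \<ge> 2" and c: "lorentz n e f = - cos (pi / real k)"
  shows "((reflect n e \<circ> reflect n f) ^^ k) x = x"
proof -
  define \<theta> where "\<theta> = pi / real k"
  define s where "s = (\<lambda>t::real. sin (t * \<theta>))"
  have "\<theta> > 0" "\<theta> < pi" using k by (auto simp: \<theta>_def field_simps)
  then have s1: "sin \<theta> > 0" by (simp add: sin_gt_zero)
  have rec: "s (t + 1) = 2 * cos \<theta> * s t - s (t - 1)" for t
    by (simp add: s_def sin_add sin_diff algebra_simps)
  let ?c = "lorentz n e f"
  have fe: "lorentz n f e = ?c" by (rule lorentz_sym)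
  have c': "?c = - cos \<theta>" by (simp add: c \<theta>_def)
  have den: "1 - ?c * ?c = sin \<theta> * sin \<theta>"
    using sin_cos_squared_add[of \<theta>] by (simp add: c' power2_eq_square)
  define a where "a = (lorentz n x e - ?c * lorentz n x f) / (1 - ?c * ?c)"
  define b where "b = (lorentz n x f - ?c * lorentz n x e) / (1 - ?c * ?c)"
  have d0: "1 - ?c * ?c \<noteq> 0" using s1 by (simp only: den) simp
  have ab: "lorentz n x e = a + b * ?c" "lorentz n x f = a * ?c + b"
    using d0 by (simp_all add: a_def b_def add_divide_distrib[symmetric] field_simps)
  define y where "y = lin_comb 1 x (-1) (lin_comb a e b f)"
  have y: "lorentz n y e = 0" "lorentz n y f = 0"
    by (simp_all add: y_def ab e f fe)
  define V where "V = (\<lambda>a b. lin_comb 1 y 1 (lin_comb a e b f))"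
  have Vx: "V a b = x" by (simp add: V_def y_def lin_comb_def fun_eq_iff)
  define A where "A = (\<lambda>m. (a * s (2 * m + 1) - b * s (2 * m)) / sin \<theta>)"
  define B where "B = (\<lambda>m. (a * s (2 * m) - b * s (2 * m - 1)) / sin \<theta>)"
  have step: "reflect n e (reflect n f (V a b)) = V (2 * cos \<theta> * (2 * cos \<theta> * a - b) - a) (2 * cos \<theta> * a - b)" for a b
  proof -
    have "reflect n f (V a b) = V a (2 * cos \<theta> * a - b)"
      unfolding reflect_def V_def
      by (simp add: y f e fe c') (simp add: lin_comb_def fun_eq_iff algebra_simps)
    moreover have "reflect n e (V a b) = V (2 * cos \<theta> * b - a) b" for a b
      unfolding reflect_def V_def
      by (simp add: y f e fe c') (simp add: lin_comb_def fun_eq_iff algebra_simps)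
    ultimately show ?thesis by simp
  qed
  have B': "2 * cos \<theta> * A m - B m = B (m + 1)" for m
  proof -
    have "s (2 * m + 2) = 2 * cos \<theta> * s (2 * m + 1) - s (2 * m)" using rec[of "2 * m + 1"] by (simp add: add.commute)
    moreover have "s (2 * m + 1) = 2 * cos \<theta> * s (2 * m) - s (2 * m - 1)" using rec[of "2 * m"] .
    ultimately have "a * s (2 * m + 2) - b * s (2 * m + 1) = 2 * cos \<theta> * (a * s (2 * m + 1) - b * s (2 * m)) - (a * s (2 * m) - b * s (2 * m - 1))"
      by (rule second_order_recurrence)
    moreover have "2 * (m + 1) = 2 * m + 2" "2 * m + 2 - 1 = 2 * m + 1" "2 * m + 2 + 1 = 2 * m + 3"
      by simp_all
    ultimately show ?thesis
      by (simp only: A_def B_def times_divide_eq_right diff_divide_distrib[symmetric])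
  qed
  have A': "2 * cos \<theta> * B (m + 1) - A m = A (m + 1)" for m
  proof -
    have "s (2 * m + 3) = 2 * cos \<theta> * s (2 * m + 2) - s (2 * m + 1)" using rec[of "2 * m + 2"] by (simp add: add.commute)
    moreover have "s (2 * m + 2) = 2 * cos \<theta> * s (2 * m + 1) - s (2 * m)" using rec[of "2 * m + 1"] by (simp add: add.commute)
    ultimately have "a * s (2 * m + 3) - b * s (2 * m + 2) = 2 * cos \<theta> * (a * s (2 * m + 2) - b * s (2 * m + 1)) - (a * s (2 * m + 1) - b * s (2 * m))"
      by (rule second_order_recurrence)
    moreover have "2 * (m + 1) = 2 * m + 2" "2 * m + 2 - 1 = 2 * m + 1" "2 * m + 2 + 1 = 2 * m + 3"
      by simp_all
    ultimately show ?thesis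
      by (simp only: A_def B_def times_divide_eq_right diff_divide_distrib[symmetric])
  qed
  have iter: "((reflect n e \<circ> reflect n f) ^^ m) x = V (A (real m)) (B (real m))" for m
  proof (induction m)
    case 0
    have "A 0 = a" "B 0 = b" using s1 by (simp_all add: A_def B_def s_def)
    then show ?case by (simp add: Vx)
  next
    case (Suc m)
    have "((reflect n e \<circ> reflect n f) ^^ Suc m) x
        = reflect n e (reflect n f (((reflect n e \<circ> reflect n f) ^^ m) x))"
      by simp
    moreover have "real (Suc m) = real m + 1" by simp
    ultimately show ?case by (simp only: Suc step B' A')
  qed
  have "real k * \<theta> = pi" using k by (simp add: \<theta>_def)
  then have th: "(2 * real k + 1) * \<theta> = 2 * pi + \<theta>" "(2 * real k) * \<theta> = 2 * pi" "(2 * real k - 1) * \<theta> = 2 * pi - \<theta>"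
    by (simp_all add: algebra_simps)
  have "A (real k) = a" "B (real k) = b"
    using s1 by (simp_all add: A_def B_def s_def th sin_add sin_diff)
  then show ?thesis
    by (simp add: iter Vx)
qed

lemma cox_label_nonzero:
  assumes e: "e \<in> facet_normals n P" and f: "f \<in> facet_normals n P"
    and k: "k \<ge> 2" and c: "lorentz n e f = - cos (pi / real k)"
  shows "cox_label (polytope_group n P) (hyp_reflection n e) (hyp_reflection n f) \<noteq> 0"
proof -
  let ?G = "polytope_group n P"
  let ?a = "hyp_reflection n e \<otimes>\<^bsub>?G\<^esub> hyp_reflection n f"
  interpret G: group ?G by (rule group_polytope_group)
  have ac: "?a \<in> carrier ?G" using e f reflection_in_polytope_group by blast
  then have "?a [^]\<^bsub>?G\<^esub> k \<in> carrier ?G" by simp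
  then have "?a [^]\<^bsub>?G\<^esub> k \<in> extensional (hyp_space n)"
    using polytope_group_carrier_subset[of n P] by (auto simp: hyp_isometries_def Bij_def)
  then have "?a [^]\<^bsub>?G\<^esub> k = \<one>\<^bsub>?G\<^esub>"
    unfolding polytope_group_one
    by (rule extensionalityI)
      (use e f k c in \<open>auto simp: reflection_product_pow reflect_product_pow_eq_id facet_normals_def unit_normals_def\<close>)
  then have "G.ord ?a dvd k" using G.pow_eq_id[OF ac] by blast
  then show ?thesis using k by (cases "G.ord ?a = 0") (auto simp: cox_label_def)
qed

context polytope
begin

text \<open>
  A point of the facet of \<open>e\<close> strictly inside the half-space of \<open>f\<close> is fixed by one
  reflection and moved by the other.
\<close>

lemma inj_on_facet_reflections: "inj_on (hyp_reflection n) (facet_normals n P)"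
proof (rule inj_onI, rule ccontr)
  fix e f assume e: "e \<in> facet_normals n P" and f: "f \<in> facet_normals n P"
    and eq: "hyp_reflection n e = hyp_reflection n f" and "e \<noteq> f"
  obtain p where p: "p \<in> hyp_space n" "lorentz n p e = 0" "lorentz n p f < 0"
    using facet_point_strict[OF e] f \<open>e \<noteq> f\<close> by blast
  have "reflect n e p = reflect n f p"
    using fun_cong[OF eq, of p] p(1) by (simp add: hyp_reflection_eq)
  then have "lorentz n (reflect n e p) f = lorentz n (reflect n f p) f" by simp
  then have "lorentz n p f = - lorentz n p f"
    using p unit_normals_unit[OF facet_unit[OF f]] by (simp add: reflect_def)
  then show False using p(3) by simp
qed

text \<open>
  The reflections commute. At a point \<open>p\<close> of the facet of \<open>e\<close> off the hyperplane of
  \<open>f\<close>, this says that the reflection in \<open>e\<close> fixes the mirror image of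
  \<open>p\<close> in the hyperplane of \<open>f\<close>.
\<close>

lemma cox_label_2_orth:
  assumes e: "e \<in> facet_normals n P" and f: "f \<in> facet_normals n P" and "e \<noteq> f"
    and lab: "cox_label (polytope_group n P) (hyp_reflection n e) (hyp_reflection n f) = 2"
  shows "lorentz n e f = 0"
proof (rule ccontr)
  assume c: "lorentz n e f \<noteq> 0"
  let ?G = "polytope_group n P"
  let ?a = "hyp_reflection n e \<otimes>\<^bsub>?G\<^esub> hyp_reflection n f"
  interpret G: group ?G by (rule group_polytope_group)
  have ac: "?a \<in> carrier ?G" using e f reflection_in_polytope_group by blast
  have "?a [^]\<^bsub>?G\<^esub> G.ord ?a = \<one>\<^bsub>?G\<^esub>" using ac by (rule G.pow_ord_eq_1)
  then have one: "?a [^]\<^bsub>?G\<^esub> (2::nat) = \<one>\<^bsub>?G\<^esub>" using lab by (simp add: cox_label_def)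
  have eu: "lorentz n e e = 1" "lorentz n f f = 1"
    using e f facet_unit unit_normals_unit by auto
  obtain p where p: "p \<in> hyp_space n" "lorentz n p e = 0" "lorentz n p f < 0"
    using facet_point_strict[OF e] f \<open>e \<noteq> f\<close> by blast
  have "((reflect n e \<circ> reflect n f) ^^ 2) p = p"
    using reflection_product_pow[OF e f p(1), of 2] one p(1) by (simp add: polytope_group_one)
  then have "reflect n e (reflect n f (reflect n e (reflect n f p))) = p"
    by (simp add: numeral_2_eq_2)
  then have "reflect n f (reflect n e p) = reflect n e (reflect n f p)"
    by (metis reflect_reflect eu)
  moreover have "reflect n e p = p"
    using p by (simp add: reflect_def lin_comb_def)
  ultimately have "lorentz n (reflect n f p) e = lorentz n (reflect n e (reflect n f p)) e"
    by simp
  then have "lorentz n (reflect n f p) e = 0"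
    using eu by (simp add: reflect_def[of n e])
  then have "lorentz n p f * lorentz n f e = 0"
    using p by (simp add: reflect_def)
  then show False using p c by (simp add: lorentz_sym[of n f e])
qed

end

text \<open>
  The number of facets will be finite because it equals the rank of the Coxeter system.
\<close>

locale coxeter_polytope = polytope +
  assumes cox: "hyp_coxeter_polytope n P"
    and fin: "finite (facet_normals n P)"
begin

text \<open>
  The label \<open>\<infinity>\<close> alone does not keep the hyperplanes apart: a priori the product of the
  reflections could be a rotation by an irrational multiple of \<open>\<pi>\<close>, as long as the
  hyperplanes meet outside \<open>P\<close>. If every facet \<open>g\<close> with a finite label to
  \<open>e\<close> is orthogonal to \<open>e\<close> and \<open>f\<close>, this cannot happen. A crossing
  would yield an adjacent facet \<open>g\<close> on the way from \<open>e\<close> to \<open>f\<close>; the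
  dihedral angle makes the label of \<open>e\<close> and \<open>g\<close> finite, and the orthogonality
  contradicts \<open>\<langle>d, g\<rangle> > 0\<close>.
\<close>

lemma infinite_label_lorentz_le:
  assumes e: "e \<in> facet_normals n P" and f: "f \<in> facet_normals n P" and "e \<noteq> f"
    and lab: "\<And>g. g \<in> facet_normals n P \<Longrightarrow> g \<noteq> e \<Longrightarrow>
      cox_label (polytope_group n P) (hyp_reflection n e) (hyp_reflection n g) = 0 \<or>
      lorentz n e g = 0 \<and> lorentz n f g = 0"
  shows "lorentz n e f \<le> -1"
proof (rule ccontr)
  assume "\<not> lorentz n e f \<le> -1"
  then have c: "\<bar>lorentz n e f\<bar> < 1"
    using facet_lorentz_less_1[OF e f \<open>e \<noteq> f\<close>] by simp
  obtain g where g: "g \<in> facet_normals n P" "g \<noteq> e"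
    "lorentz n (lin_comb 1 f (- lorentz n e f) e) g > 0"
    "has_dihedral_angle n P e g (arccos (- lorentz n e g))" "\<bar>lorentz n e g\<bar> < 1"
    by (rule adjacent_facet_exists[OF fin e f \<open>e \<noteq> f\<close> c])
  have "arccos (- lorentz n e g) = 0 \<or> (\<exists>k::nat. k \<ge> 2 \<and> arccos (- lorentz n e g) = pi / real k)"
    using cox g(4) unfolding hyp_coxeter_polytope_def by blast
  moreover have cosa: "cos (arccos (- lorentz n e g)) = - lorentz n e g"
    using g(5) by (intro cos_arccos) auto
  moreover have "arccos (- lorentz n e g) \<noteq> 0"
    using cosa g(5) by (metis cos_zero abs_minus_cancel abs_one less_irrefl)
  ultimately obtain k :: nat where k: "k \<ge> 2" "- lorentz n e g = cos (pi / real k)"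
    by metis
  then have "cox_label (polytope_group n P) (hyp_reflection n e) (hyp_reflection n g) \<noteq> 0"
    by (intro cox_label_nonzero[OF e g(1) k(1)]) simp
  with lab[OF g(1,2)] have "lorentz n e g = 0" "lorentz n f g = 0" by auto
  then show False using g(3) by simp
qed

end

section \<open>Products of universal Coxeter systems are not hyperbolic\<close>

lemma sum_of_three_timelike:
  assumes "lorentz n e e = 1" "lorentz n f f = 1" "lorentz n g g = 1"
    and "lorentz n e f \<le> -1" "lorentz n e g \<le> -1" "lorentz n f g \<le> -1"
  shows "lorentz n (lin_comb 1 e 1 (lin_comb 1 f 1 g)) (lin_comb 1 e 1 (lin_comb 1 f 1 g)) < 0"
  using assms by (simp add: lorentz_sym[of n f e] lorentz_sym[of n g e] lorentz_sym[of n g f])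

lemma three_distinct_elements:
  assumes "card A \<ge> 3"
  obtains x y z where "x \<in> A" "y \<in> A" "z \<in> A" "x \<noteq> y" "x \<noteq> z" "y \<noteq> z"
proof -
  obtain B where "B \<subseteq> A" "card B = 3"
    using obtain_subset_with_card_n[OF assms] by blast
  then obtain x y z where "B = {x, y, z}" "x \<noteq> y" "x \<noteq> z" "y \<noteq> z"
    by (auto simp: card_3_iff)
  with \<open>B \<subseteq> A\<close> show ?thesis by (intro that[of x y z]) auto
qed

text \<open>
  The product of two universal Coxeter systems of rank at least 3 is not hyperbolic. Three facet normals from
  the same factor have pairwise products at most \<open>-1\<close>, so their sum is timelike. The two factors
  would provide two orthogonal timelike vectors.
\<close>

lemma not_hyperbolic_product:
  assumes "finite S" "S = A \<union> B" "A \<inter> B = {}" "card A \<ge> 3" "card B \<ge> 3"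
    and AA: "\<And>s t. s \<in> A \<Longrightarrow> t \<in> A \<Longrightarrow> s \<noteq> t \<Longrightarrow> cox_label G s t = 0"
    and BB: "\<And>s t. s \<in> B \<Longrightarrow> t \<in> B \<Longrightarrow> s \<noteq> t \<Longrightarrow> cox_label G s t = 0"
    and AB: "\<And>s t. s \<in> A \<Longrightarrow> t \<in> B \<Longrightarrow> cox_label G s t = 2"
    and BA: "\<And>s t. s \<in> A \<Longrightarrow> t \<in> B \<Longrightarrow> cox_label G t s = 2"
  shows "\<not> hyperbolic_system G S"
proof
  assume "hyperbolic_system G S"
  then obtain n P where cox: "hyp_coxeter_polytope n P" and
    iso: "coxeter_iso G S (polytope_group n P) (polytope_reflections n P)"
    unfolding hyperbolic_system_def by blast
  let ?F = "facet_normals n P"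
  let ?r = "hyp_reflection n"
  interpret polytope n P
    using cox by unfold_locales (simp add: hyp_coxeter_polytope_def)
  obtain f where f: "bij_betw f S (?r ` ?F)"
    and lab: "\<And>s t. s \<in> S \<Longrightarrow> t \<in> S \<Longrightarrow> cox_label (polytope_group n P) (f s) (f t) = cox_label G s t"
    using iso unfolding coxeter_iso_def polytope_reflections_def by blast
  have r: "bij_betw ?r ?F (?r ` ?F)"
    using inj_on_facet_reflections by (simp add: bij_betw_def)
  define h where "h = inv_into ?F ?r \<circ> f"
  have h: "bij_betw h S ?F"
    unfolding h_def using f bij_betw_inv_into[OF r] by (rule bij_betw_trans)
  have rh: "?r (h s) = f s" if "s \<in> S" for s
  proof -
    have "f s \<in> ?r ` ?F" using f that by (auto simp: bij_betw_def)
    then show ?thesis by (simp add: h_def f_inv_into_f)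
  qed
  have hF: "h s \<in> ?F" if "s \<in> S" for s using h that by (auto simp: bij_betw_def)
  have hS: "\<exists>s\<in>S. g = h s" if "g \<in> ?F" for g using h that by (auto simp: bij_betw_def)
  have hneq: "h s \<noteq> h t" if "s \<in> S" "t \<in> S" "s \<noteq> t" for s t
    using h that by (auto simp: bij_betw_def inj_on_def)
  interpret coxeter_polytope n P
    using cox \<open>finite S\<close> bij_betw_finite[OF h] by unfold_locales auto
  have labh: "cox_label (polytope_group n P) (?r (h s)) (?r (h t)) = cox_label G s t"
    if "s \<in> S" "t \<in> S" for s t
    using lab[OF that] that by (simp add: rh)
  have unit: "lorentz n (h s) (h s) = 1" if "s \<in> S" for s
    using unit_normals_unit[OF facet_unit[OF hF[OF that]]] .
  have orth: "lorentz n (h s) (h t) = 0" if "s \<in> A" "t \<in> B" for s t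
    using cox_label_2_orth[of "h s" "h t"] hF hneq[of s t] labh[of s t] AB[OF that] that assms(2,3) by auto
  have *: "lorentz n (h s) (h t) \<le> -1" if X: "(X = A \<and> Y = B) \<or> (X = B \<and> Y = A)"
      and st: "s \<in> X" "t \<in> X" "s \<noteq> t" for s t X Y
  proof -
    have S: "s \<in> S" "t \<in> S" using X st assms(2) by auto
    show ?thesis
    proof (rule infinite_label_lorentz_le)
      fix g assume "g \<in> ?F" "g \<noteq> h s"
      then obtain u where u: "u \<in> S" "g = h u" "u \<noteq> s" using hS by blast
      consider "u \<in> X" | "u \<in> Y" using u(1) X assms(2) by auto
      then show "cox_label (polytope_group n P) (?r (h s)) (?r g) = 0 \<or>
        lorentz n (h s) g = 0 \<and> lorentz n (h t) g = 0"
      proof cases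
        case 1
        then have "cox_label G s u = 0" using X st(1) u(3) AA[of s u] BB[of s u] by blast
        then show ?thesis using labh[OF S(1) u(1)] u(2) by simp
      next
        case 2
        then have "lorentz n (h s) (h u) = 0" "lorentz n (h t) (h u) = 0"
          using X st orth lorentz_sym by metis+
        then show ?thesis using u(2) by simp
      qed
    qed (use S st hF hneq in auto)
  qed
  obtain a b c where abc: "a \<in> A" "b \<in> A" "c \<in> A" "a \<noteq> b" "a \<noteq> c" "b \<noteq> c"
    by (rule three_distinct_elements[OF \<open>card A \<ge> 3\<close>])
  obtain x y z where xyz: "x \<in> B" "y \<in> B" "z \<in> B" "x \<noteq> y" "x \<noteq> z" "y \<noteq> z"
    by (rule three_distinct_elements[OF \<open>card B \<ge> 3\<close>])
  define v where "v = lin_comb 1 (h a) 1 (lin_comb 1 (h b) 1 (h c))"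
  define w where "w = lin_comb 1 (h x) 1 (lin_comb 1 (h y) 1 (h z))"
  have vv: "lorentz n v v < 0"
    unfolding v_def using abc assms(2) by (intro sum_of_three_timelike unit *[where X=A and Y=B]) auto
  have ww: "lorentz n w w < 0"
    unfolding w_def using xyz assms(2) by (intro sum_of_three_timelike unit *[where X=B and Y=A]) auto
  have vw: "lorentz n v w = 0"
    using abc xyz orth by (simp add: v_def w_def)
  have "h s \<in> minkowski_space n" if "s \<in> S" for s
    using unit_normals_minkowski[OF facet_unit[OF hF[OF that]]] .
  then have "w \<in> minkowski_space n"
    unfolding w_def using xyz assms(2) by auto
  moreover have "w \<noteq> (\<lambda>_. 0)"
    using ww by (auto simp: lorentz_def)
  ultimately show False
    using timelike_orth_spacelike[OF vv _ vw] ww by simp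
qed

section \<open>Evaluation of words in group presentations\<close>

lemma eval_word_Nil [simp]: "eval_word G [] = \<one>\<^bsub>G\<^esub>"
  and eval_word_Cons [simp]: "eval_word G (l # w) = eval_letter G l \<otimes>\<^bsub>G\<^esub> eval_word G w"
  by (simp_all add: eval_word_def)

context group
begin

lemma eval_letter_closed: "S \<subseteq> carrier G \<Longrightarrow> l \<in> letters S \<Longrightarrow> eval_letter G l \<in> carrier G"
  by (auto simp: eval_letter_def letters_def)

lemma eval_word_closed: "S \<subseteq> carrier G \<Longrightarrow> w \<in> lists (letters S) \<Longrightarrow> eval_word G w \<in> carrier G"
  by (induction w) (auto simp: eval_letter_closed)

lemma eval_word_append:
  assumes "S \<subseteq> carrier G" "v \<in> lists (letters S)" "w \<in> lists (letters S)"
  shows "eval_word G (v @ w) = eval_word G v \<otimes> eval_word G w"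
  using assms(2)
  by (induction v) (use assms(1,3) in \<open>auto simp: m_assoc eval_letter_closed eval_word_closed\<close>)

lemma eval_word_relator:
  assumes "S \<subseteq> carrier G" "s \<in> S" "t \<in> S"
  shows "eval_word G (concat (replicate k [(s, True), (t, True)])) = (s \<otimes> t) [^] k"
proof -
  have st: "s \<in> carrier G" "t \<in> carrier G" using assms by auto
  show ?thesis
  proof (induction k)
    case (Suc k)
    have "eval_word G (concat (replicate (Suc k) [(s, True), (t, True)])) = s \<otimes> (t \<otimes> (s \<otimes> t) [^] k)"
      using Suc by (simp add: eval_letter_def)
    also have "\<dots> = (s \<otimes> t) [^] Suc k"
      using st by (subst nat_pow_Suc2) (simp_all add: m_assoc)
    finally show ?case .
  qed simp
qed

lemma word_equiv_imp_eval_eq: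
  assumes S: "S \<subseteq> carrier G" and R: "R \<subseteq> lists (letters S)"
    and r1: "\<And>r. r \<in> R \<Longrightarrow> eval_word G r = \<one>"
    and "word_equiv S R v w"
  shows "v \<in> lists (letters S) \<and> w \<in> lists (letters S) \<and> eval_word G v = eval_word G w"
  using assms(4)
proof (induction rule: word_equiv.induct)
  case (cancel u v s b)
  have s: "s \<in> carrier G" "(s, b) \<in> letters S" "(s, \<not> b) \<in> letters S"
    using cancel S by (auto simp: letters_def)
  have "eval_word G ([(s, b), (s, \<not> b)] @ v) = eval_word G v"
    using s cancel eval_word_closed[OF S cancel(2)]
    by (cases b) (simp_all add: eval_letter_def m_assoc[symmetric])
  then show ?case
    using cancel s by (auto simp: eval_word_append[OF S])
next
  case (relator u v r)
  then show ?case
    using R r1 eval_word_closed[OF S] by (auto simp: eval_word_append[OF S] subset_iff)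
qed auto

end

lemma word_equiv_context:
  assumes "word_equiv S R v w" "a \<in> lists (letters S)" "b \<in> lists (letters S)"
  shows "word_equiv S R (a @ v @ b) (a @ w @ b)"
  using assms(1)
proof (induction rule: word_equiv.induct)
  case (refl w)
  then show ?case using assms by (intro word_equiv.refl) auto
next
  case (cancel u v s c)
  then show ?case
    using word_equiv.cancel[of "a @ u" S "v @ b" s R c] assms by auto
next
  case (relator u v r)
  then show ?case
    using word_equiv.relator[of "a @ u" S "v @ b" r R] assms by auto
qed (blast intro: word_equiv.intros)+

section \<open>Free products of involutions\<close>

fun cancel_cons :: "nat \<Rightarrow> nat list \<Rightarrow> nat list" where
  "cancel_cons a [] = [a]"
| "cancel_cons a (b # w) = (if a = b then w else a # b # w)"

definition reduced_words :: "nat \<Rightarrow> nat list set" where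
  "reduced_words n = {w \<in> lists {..<n}. distinct_adj w}"

lemma cancel_cons_distinct_adj: "distinct_adj w \<Longrightarrow> distinct_adj (cancel_cons a w)"
  by (cases w) (auto simp: distinct_adj_Cons)

lemma foldr_cancel_cons_distinct_adj: "distinct_adj w \<Longrightarrow> distinct_adj (foldr cancel_cons v w)"
  by (induction v) (auto simp: cancel_cons_distinct_adj)

lemma cancel_cons_reduced: "w \<in> reduced_words n \<Longrightarrow> a < n \<Longrightarrow> cancel_cons a w \<in> reduced_words n"
  by (cases w) (auto simp: reduced_words_def distinct_adj_Cons)

lemma foldr_cancel_cons_reduced:
  "v \<in> lists {..<n} \<Longrightarrow> w \<in> reduced_words n \<Longrightarrow> foldr cancel_cons v w \<in> reduced_words n"
  by (induction v) (simp_all add: cancel_cons_reduced)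

lemma cancel_cons_involution: "distinct_adj w \<Longrightarrow> cancel_cons a (cancel_cons a w) = w"
  by (cases w rule: remdups_adj.cases) auto

lemma foldr_cancel_cons_Nil: "distinct_adj w \<Longrightarrow> foldr cancel_cons w [] = w"
proof (induction w)
  case (Cons a w)
  then show ?case by (cases w) (auto simp: distinct_adj_Cons)
qed simp

text \<open>
  Multiplying by a letter is an involution on reduced words, so cancelling two letters in the left factor does
  not change its action on \<open>w\<close>. This gives associativity without any discussion of confluence.
\<close>

lemma foldr_cancel_cons_assoc:
  assumes "distinct_adj w"
  shows "foldr cancel_cons (foldr cancel_cons u v) w = foldr cancel_cons u (foldr cancel_cons v w)"
proof -
  have *: "foldr cancel_cons (cancel_cons a v) w = cancel_cons a (foldr cancel_cons v w)" for a v
    using assms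
    by (cases v) (auto simp: cancel_cons_involution foldr_cancel_cons_distinct_adj)
  show ?thesis by (induction u) (auto simp: *)
qed

lemma foldr_cancel_cons_rev: "foldr cancel_cons (rev w) w = []"
  by (induction w) auto

definition involution_free_product :: "nat \<Rightarrow> nat list monoid" where
  "involution_free_product n = \<lparr>carrier = reduced_words n, monoid.mult = foldr cancel_cons, one = []\<rparr>"

lemma group_involution_free_product: "group (involution_free_product n)"
proof (rule groupI)
  fix x assume x: "x \<in> carrier (involution_free_product n)"
  then have "rev x \<in> carrier (involution_free_product n)"
    by (auto simp: involution_free_product_def reduced_words_def)
  then show "\<exists>y\<in>carrier (involution_free_product n).
      y \<otimes>\<^bsub>involution_free_product n\<^esub> x = \<one>\<^bsub>involution_free_product n\<^esub>"
    by (intro bexI[of _ "rev x"]) (simp_all add: involution_free_product_def foldr_cancel_cons_rev)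
qed (auto simp: involution_free_product_def reduced_words_def foldr_cancel_cons_assoc
    intro!: foldr_cancel_cons_reduced[unfolded reduced_words_def, simplified])

section \<open>The square of a free product of involutions\<close>

text \<open>
  An injection of pairs of words into sets of words, the type in which the groups are to live. The first
  letters 0 and 1 mark the two components.
\<close>

definition pair_code :: "nat list \<times> nat list \<Rightarrow> nat list set" where
  "pair_code p = {0 # fst p, Suc 0 # snd p}"

lemma inj_pair_code: "inj pair_code"
  by (auto simp: inj_def pair_code_def doubleton_eq_iff)

lemma pair_code_eq_iff [simp]: "pair_code p = pair_code q \<longleftrightarrow> p = q"
  by (rule inj_eq[OF inj_pair_code])

definition square_group :: "nat \<Rightarrow> nat list set monoid" where
  "square_group n = image_group pair_code (involution_free_product n \<times>\<times> involution_free_product n)"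

text \<open>
  The boolean selects the factor: \<open>True\<close> for the first component, \<open>False\<close> for the
  second.
\<close>

fun act :: "bool \<times> nat \<Rightarrow> nat list \<times> nat list \<Rightarrow> nat list \<times> nat list" where
  "act (b, i) (u, v) = (if b then (cancel_cons i u, v) else (u, cancel_cons i v))"

definition generator :: "bool \<times> nat \<Rightarrow> nat list set" where
  "generator x = pair_code (act x ([], []))"

definition indices :: "nat \<Rightarrow> (bool \<times> nat) set" where
  "indices n = UNIV \<times> {..<n}"

definition generators :: "nat \<Rightarrow> nat list set set" where
  "generators n = generator ` indices n"

abbreviation reduced_pairs :: "nat \<Rightarrow> (nat list \<times> nat list) set" where
  "reduced_pairs n \<equiv> reduced_words n \<times> reduced_words n"

lemma group_square_group: "group (square_group n)"
proof -
  interpret D: group "involution_free_product n \<times>\<times> involution_free_product n"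
    by (intro DirProd_group group_involution_free_product)
  show ?thesis
    unfolding square_group_def
    by (rule D.inj_imp_image_group_is_group) (rule inj_on_subset[OF inj_pair_code subset_UNIV])
qed

lemma carrier_square_group: "carrier (square_group n) = pair_code ` reduced_pairs n"
  by (simp add: square_group_def image_group_carrier DirProd_def involution_free_product_def)

lemma one_square_group: "\<one>\<^bsub>square_group n\<^esub> = pair_code ([], [])"
  by (simp add: square_group_def image_group_one DirProd_def involution_free_product_def)

lemma mult_square_group:
  assumes "p \<in> reduced_pairs n" "q \<in> reduced_pairs n"
  shows "pair_code p \<otimes>\<^bsub>square_group n\<^esub> pair_code q
    = pair_code (foldr cancel_cons (fst p) (fst q), foldr cancel_cons (snd p) (snd q))"
proof -
  have "inj_on pair_code (reduced_pairs n)"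
    by (rule inj_on_subset[OF inj_pair_code subset_UNIV])
  then show ?thesis
    using assms
    by (simp add: square_group_def image_group_def DirProd_def involution_free_product_def
        inv_into_f_f case_prod_unfold)
qed

lemma generator_eq_iff [simp]: "generator x = generator y \<longleftrightarrow> x = y"
  by (cases x; cases y) (auto simp: generator_def)

lemma inj_on_generator: "inj_on generator A"
  by (auto simp: inj_on_def)

lemma act_reduced: "x \<in> indices n \<Longrightarrow> p \<in> reduced_pairs n \<Longrightarrow> act x p \<in> reduced_pairs n"
  by (cases x; cases p)
    (auto simp: indices_def cancel_cons_reduced)

lemma Nil_reduced [simp]: "([], []) \<in> reduced_pairs n"
  by (simp add: reduced_words_def)

lemma generator_carrier: "x \<in> indices n \<Longrightarrow> generator x \<in> carrier (square_group n)"
  unfolding carrier_square_group generator_def using act_reduced[OF _ Nil_reduced] by blast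

lemma generators_carrier: "generators n \<subseteq> carrier (square_group n)"
  using generator_carrier by (auto simp: generators_def)

lemma generator_mult:
  assumes "x \<in> indices n" "p \<in> reduced_pairs n"
  shows "generator x \<otimes>\<^bsub>square_group n\<^esub> pair_code p = pair_code (act x p)"
  unfolding generator_def
  by (subst mult_square_group[OF act_reduced[OF assms(1) Nil_reduced] assms(2)])
    (cases x; cases p; simp)

lemma foldr_act_reduced:
  "xs \<in> lists (indices n) \<Longrightarrow> foldr act xs ([], []) \<in> reduced_pairs n"
  by (induction xs) (auto simp del: act.simps mem_Sigma_iff intro: act_reduced simp: act_reduced)

lemma product_of_generators:
  assumes "xs \<in> lists (indices n)"
  shows "foldr (\<lambda>s h. s \<otimes>\<^bsub>square_group n\<^esub> h) (map generator xs) \<one>\<^bsub>square_group n\<^esub>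
    = pair_code (foldr act xs ([], []))"
  using assms
  by (induction xs) (auto simp: one_square_group generator_mult foldr_act_reduced simp del: mem_Sigma_iff)

definition normal_form :: "nat list \<times> nat list \<Rightarrow> (bool \<times> nat) list" where
  "normal_form p = map (Pair True) (fst p) @ map (Pair False) (snd p)"

lemma normal_form_indices: "p \<in> reduced_pairs n \<Longrightarrow> normal_form p \<in> lists (indices n)"
  by (auto simp: normal_form_def reduced_words_def indices_def)

lemma foldr_act_normal_form:
  assumes "p \<in> reduced_pairs n"
  shows "foldr act (normal_form p) ([], []) = p"
proof -
  have "foldr act (map (Pair True) u) (a, b) = (foldr cancel_cons u a, b)" for u a b
    by (induction u) auto
  moreover have "foldr act (map (Pair False) u) (a, b) = (a, foldr cancel_cons u b)" for u a b
    by (induction u) auto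
  ultimately show ?thesis
    using assms by (auto simp: normal_form_def reduced_words_def foldr_cancel_cons_Nil)
qed

section \<open>Coxeter labels\<close>

lemma finite_generators: "finite (generators n)"
  by (simp add: generators_def indices_def)

lemma card_generators: "card (generators n) = 2 * n"
  by (simp add: generators_def card_image[OF inj_on_generator] indices_def card_cartesian_product)

lemma generator_product:
  assumes "x \<in> indices n" "y \<in> indices n"
  shows "generator x \<otimes>\<^bsub>square_group n\<^esub> generator y = pair_code (act x (act y ([], [])))"
  unfolding generator_def[of y] by (rule generator_mult[OF assms(1) act_reduced[OF assms(2) Nil_reduced]])

lemma generator_product_pow:
  assumes "x \<in> indices n" "y \<in> indices n"
  shows "(generator x \<otimes>\<^bsub>square_group n\<^esub> generator y) [^]\<^bsub>square_group n\<^esub> k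
     = pair_code (((act x \<circ> act y) ^^ k) ([], []))"
    and "((act x \<circ> act y) ^^ k) ([], []) \<in> reduced_pairs n"
proof -
  interpret group "square_group n" by (rule group_square_group)
  have c: "generator x \<in> carrier (square_group n)" "generator y \<in> carrier (square_group n)"
    using assms generator_carrier by auto
  have "(generator x \<otimes>\<^bsub>square_group n\<^esub> generator y) [^]\<^bsub>square_group n\<^esub> k
     = pair_code (((act x \<circ> act y) ^^ k) ([], [])) \<and> ((act x \<circ> act y) ^^ k) ([], []) \<in> reduced_pairs n"
  proof (induction k)
    case 0
    then show ?case by (simp add: one_square_group reduced_words_def)
  next
    case (Suc k)
    define q where "q = ((act x \<circ> act y) ^^ k) ([], [])"
    have q: "q \<in> reduced_pairs n" using Suc unfolding q_def by (rule conjunct2)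
    have "(generator x \<otimes>\<^bsub>square_group n\<^esub> generator y) [^]\<^bsub>square_group n\<^esub> Suc k
       = generator x \<otimes>\<^bsub>square_group n\<^esub> (generator y \<otimes>\<^bsub>square_group n\<^esub> pair_code q)"
    proof -
      have "pair_code q \<in> carrier (square_group n)" using q by (simp add: carrier_square_group)
      moreover have "(generator x \<otimes>\<^bsub>square_group n\<^esub> generator y) [^]\<^bsub>square_group n\<^esub> k = pair_code q"
        using Suc unfolding q_def by (rule conjunct1)
      ultimately show ?thesis
        using c by (subst nat_pow_Suc2) (simp_all add: m_assoc)
    qed
    also have "\<dots> = pair_code (act x (act y q))"
      using q assms by (simp add: generator_mult act_reduced del: mem_Sigma_iff act.simps)
    finally have "(generator x \<otimes>\<^bsub>square_group n\<^esub> generator y) [^]\<^bsub>square_group n\<^esub> Suc k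
       = pair_code (act x (act y q))" .
    moreover have "((act x \<circ> act y) ^^ Suc k) ([], []) = act x (act y q)"
      by (simp add: q_def)
    moreover have "act x (act y q) \<in> reduced_pairs n"
      using q assms by (intro act_reduced)
    ultimately show ?case by (simp only: simp_thms)
  qed
  then show "(generator x \<otimes>\<^bsub>square_group n\<^esub> generator y) [^]\<^bsub>square_group n\<^esub> k
     = pair_code (((act x \<circ> act y) ^^ k) ([], []))"
    "((act x \<circ> act y) ^^ k) ([], []) \<in> reduced_pairs n" by blast+
qed

text \<open>
  The powers of a product of two generators of one factor are alternating words without cancellation, so the
  product has infinite order.
\<close>

lemma alternating_word:
  assumes "i \<noteq> j"
  shows "fst (((act (True, i) \<circ> act (True, j)) ^^ k) ([], [])) = concat (replicate k [i, j])"
    "snd (((act (False, i) \<circ> act (False, j)) ^^ k) ([], [])) = concat (replicate k [i, j])"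
proof -
  have *: "concat (replicate k [i, j]) = [] \<or> hd (concat (replicate k [i, j])) = i" for k
    by (cases k) auto
  have cc: "cancel_cons i (cancel_cons j (concat (replicate k [i, j]))) = i # j # concat (replicate k [i, j])" for k
    using *[of k] assms by (cases "concat (replicate k [i, j])") auto
  have 1: "((act (True, i) \<circ> act (True, j)) ^^ k) ([], []) = (concat (replicate k [i, j]), [])"
    by (induction k) (auto simp: cc)
  have 2: "((act (False, i) \<circ> act (False, j)) ^^ k) ([], []) = ([], concat (replicate k [i, j]))"
    by (induction k) (auto simp: cc)
  show "fst (((act (True, i) \<circ> act (True, j)) ^^ k) ([], [])) = concat (replicate k [i, j])"
    "snd (((act (False, i) \<circ> act (False, j)) ^^ k) ([], [])) = concat (replicate k [i, j])"
    by (simp_all add: 1 2)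
qed

lemma label_same: "x \<in> indices n \<Longrightarrow> cox_label (square_group n) (generator x) (generator x) = 1"
proof -
  assume x: "x \<in> indices n"
  interpret group "square_group n" by (rule group_square_group)
  have "generator x \<otimes>\<^bsub>square_group n\<^esub> generator x = \<one>\<^bsub>square_group n\<^esub>"
    by (subst generator_product[OF x x], cases x) (auto simp: one_square_group)
  then show ?thesis by (simp add: cox_label_def)
qed

lemma label_same_side:
  assumes "(b, i) \<in> indices n" "(b, j) \<in> indices n" "i \<noteq> j"
  shows "cox_label (square_group n) (generator (b, i)) (generator (b, j)) = 0"
proof -
  interpret group "square_group n" by (rule group_square_group)
  have c: "generator (b, i) \<otimes>\<^bsub>square_group n\<^esub> generator (b, j) \<in> carrier (square_group n)"
    using assms generator_carrier by auto
  have "(generator (b, i) \<otimes>\<^bsub>square_group n\<^esub> generator (b, j)) [^]\<^bsub>square_group n\<^esub> k \<noteq> \<one>\<^bsub>square_group n\<^esub>"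
    if "k \<noteq> 0" for k :: nat
  proof
    assume "(generator (b, i) \<otimes>\<^bsub>square_group n\<^esub> generator (b, j)) [^]\<^bsub>square_group n\<^esub> k = \<one>\<^bsub>square_group n\<^esub>"
    then have "((act (b, i) \<circ> act (b, j)) ^^ k) ([], []) = ([], [])"
      using assms by (simp add: generator_product_pow(1) one_square_group)
    then have "concat (replicate k [i, j]) = []"
      using alternating_word[OF assms(3), of k] by (cases b) auto
    then show False using that by (cases k) auto
  qed
  then show ?thesis
    using c by (simp add: cox_label_def ord_eq_0)
qed

lemma label_opposite:
  assumes "(b, i) \<in> indices n" "(\<not> b, j) \<in> indices n"
  shows "cox_label (square_group n) (generator (b, i)) (generator (\<not> b, j)) = 2"
proof -
  interpret group "square_group n" by (rule group_square_group)
  let ?a = "generator (b, i) \<otimes>\<^bsub>square_group n\<^esub> generator (\<not> b, j)"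
  have c: "?a \<in> carrier (square_group n)"
    using assms generator_carrier by auto
  have "?a [^]\<^bsub>square_group n\<^esub> (2::nat) = \<one>\<^bsub>square_group n\<^esub>"
    unfolding generator_product_pow(1)[OF assms] one_square_group
    by (cases b) (simp_all add: numeral_2_eq_2)
  then have "ord ?a dvd 2" using c pow_eq_id by blast
  moreover have "ord ?a \<noteq> 1"
    using c assms by (subst ord_eq_1) (simp_all add: generator_product one_square_group)
  ultimately show ?thesis
    by (metis cox_label_def prime_nat_iff two_is_prime_nat)
qed

section \<open>The Coxeter presentation\<close>

abbreviation relators :: "nat \<Rightarrow> nat list set word set" where
  "relators n \<equiv> coxeter_relators (generators n) (cox_label (square_group n))"

lemma generator_in_generators: "x \<in> indices n \<Longrightarrow> generator x \<in> generators n"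
  by (simp add: generators_def)

lemma relators_letters: "relators n \<subseteq> lists (letters (generators n))"
proof -
  have "concat (replicate k [(s, True), (t, True)]) \<in> lists (letters S)" if "s \<in> S" "t \<in> S" for s t k and S :: "nat list set set"
    using that by (induction k) (auto simp: letters_def)
  then show ?thesis unfolding coxeter_relators_def by blast
qed

lemma eval_relators: "r \<in> relators n \<Longrightarrow> eval_word (square_group n) r = \<one>\<^bsub>square_group n\<^esub>"
proof -
  assume "r \<in> relators n"
  interpret group "square_group n" by (rule group_square_group)
  obtain s t where st: "s \<in> generators n" "t \<in> generators n"
      "r = concat (replicate (cox_label (square_group n) s t) [(s, True), (t, True)])"
    using \<open>r \<in> relators n\<close> by (auto simp: coxeter_relators_def)
  have "s \<otimes>\<^bsub>square_group n\<^esub> t \<in> carrier (square_group n)"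
    using st generators_carrier by blast
  then show ?thesis
    unfolding st(3) eval_word_relator[OF generators_carrier st(1,2)] cox_label_def by (rule pow_ord_eq_1)
qed

definition equivalent :: "nat \<Rightarrow> nat list set word \<Rightarrow> nat list set word \<Rightarrow> bool" where
  "equivalent n = word_equiv (generators n) (relators n)"

lemma equivalent_refl: "w \<in> lists (letters (generators n)) \<Longrightarrow> equivalent n w w"
  and equivalent_sym: "equivalent n v w \<Longrightarrow> equivalent n w v"
  and equivalent_trans [trans]: "equivalent n u v \<Longrightarrow> equivalent n v w \<Longrightarrow> equivalent n u w"
  unfolding equivalent_def by (blast intro: word_equiv.intros)+

lemma equivalent_context:
  assumes "equivalent n v w" "a \<in> lists (letters (generators n))" "b \<in> lists (letters (generators n))"
  shows "equivalent n (a @ v @ b) (a @ w @ b)"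
  using assms unfolding equivalent_def by (rule word_equiv_context)

lemma relator_equivalent_Nil: "r \<in> relators n \<Longrightarrow> equivalent n r []"
  unfolding equivalent_def using word_equiv.relator[of "[]" "generators n" "[]" r] by simp

definition pos_word :: "(bool \<times> nat) list \<Rightarrow> nat list set word" where
  "pos_word xs = map (\<lambda>x. (generator x, True)) xs"

lemma pos_word_simps [simp]:
  "pos_word [] = []" "pos_word (x # xs) = (generator x, True) # pos_word xs"
  "pos_word (xs @ ys) = pos_word xs @ pos_word ys"
  by (simp_all add: pos_word_def)

lemma pos_word_letters: "xs \<in> lists (indices n) \<Longrightarrow> pos_word xs \<in> lists (letters (generators n))"
  by (induction xs) (auto simp: letters_def generator_in_generators)

lemma square_equivalent_Nil:
  assumes "x \<in> indices n"
  shows "equivalent n (pos_word [x, x]) []"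
proof (rule relator_equivalent_Nil)
  show "pos_word [x, x] \<in> relators n"
    unfolding coxeter_relators_def
    using generator_in_generators[OF assms] label_same[OF assms]
    by (intro CollectI exI[of _ "generator x"]) simp
qed

lemma pos_word_context:
  assumes "equivalent n (pos_word v) (pos_word w)" "a \<in> lists (indices n)" "b \<in> lists (indices n)"
  shows "equivalent n (pos_word (a @ v @ b)) (pos_word (a @ w @ b))"
  using equivalent_context[OF assms(1) pos_word_letters[OF assms(2)] pos_word_letters[OF assms(3)]]
  by simp

lemma cancel_square:
  assumes "x \<in> indices n" "a \<in> lists (indices n)" "b \<in> lists (indices n)"
  shows "equivalent n (pos_word (a @ x # x # b)) (pos_word (a @ b))"
  using pos_word_context[of n "[x, x]" "[]" a b] square_equivalent_Nil[OF assms(1)] assms(2,3) by simp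

lemma commute_equivalent:
  assumes x: "(b, i) \<in> indices n" and y: "(\<not> b, j) \<in> indices n"
  shows "equivalent n (pos_word [(\<not> b, j), (b, i)]) (pos_word [(b, i), (\<not> b, j)])"
proof -
  let ?x = "(b, i)" and ?y = "(\<not> b, j)"
  have "pos_word [?x, ?y, ?x, ?y] \<in> relators n"
    unfolding coxeter_relators_def
    using generator_in_generators[OF x] generator_in_generators[OF y] label_opposite[OF x y]
    by (intro CollectI exI[of _ "generator ?x"] exI[of _ "generator ?y"]) (simp add: numeral_2_eq_2)
  from relator_equivalent_Nil[OF this]
  have r: "equivalent n (pos_word [?x, ?y, ?x, ?y]) (pos_word [])" by simp
  \<comment> \<open>Both sides reduce from \<open>xxyxyy\<close>, by the squares and by the relator \<open>xyxy\<close>.\<close>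
  have "equivalent n (pos_word ([] @ ?x # ?x # [?y, ?x, ?y, ?y])) (pos_word ([] @ [?y, ?x, ?y, ?y]))"
    by (rule cancel_square) (use x y in auto)
  moreover have "equivalent n (pos_word ([?y, ?x] @ ?y # ?y # [])) (pos_word ([?y, ?x] @ []))"
    by (rule cancel_square) (use x y in auto)
  ultimately have 1: "equivalent n (pos_word [?x, ?x, ?y, ?x, ?y, ?y]) (pos_word [?y, ?x])"
    using equivalent_trans by simp
  have "equivalent n (pos_word ([?x] @ [?x, ?y, ?x, ?y] @ [?y])) (pos_word ([?x] @ [] @ [?y]))"
    by (rule pos_word_context[OF r]) (use x y in auto)
  then have 2: "equivalent n (pos_word [?x, ?x, ?y, ?x, ?y, ?y]) (pos_word [?x, ?y])"
    by simp
  show ?thesis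
    using equivalent_trans[OF equivalent_sym[OF 1] 2] .
qed

lemma inverse_letter_equivalent:
  assumes "x \<in> indices n"
  shows "equivalent n [(generator x, False)] [(generator x, True)]"
proof -
  let ?s = "generator x"
  have s: "?s \<in> generators n" using generator_in_generators[OF assms] .
  have "equivalent n ([(?s, False)] @ pos_word [x, x] @ []) ([(?s, False)] @ [] @ [])"
    by (rule equivalent_context[OF square_equivalent_Nil[OF assms]]) (use s in \<open>auto simp: letters_def\<close>)
  moreover have "equivalent n ([] @ [(?s, False), (?s, \<not> False)] @ [(?s, True)]) ([] @ [(?s, True)])"
    unfolding equivalent_def by (rule word_equiv.cancel) (use s in \<open>auto simp: letters_def\<close>)
  ultimately have "equivalent n [(?s, False), (?s, True), (?s, True)] [(?s, False)]"
      "equivalent n [(?s, False), (?s, True), (?s, True)] [(?s, True)]"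
    by simp_all
  then show ?thesis
    by (blast intro: equivalent_trans equivalent_sym)
qed

lemma cancel_cons_equivalent:
  assumes "(b, i) \<in> indices n" "u \<in> lists {..<n}" "w \<in> lists (indices n)" "a \<in> lists (indices n)"
  shows "equivalent n (pos_word (a @ (b, i) # map (Pair b) u @ w)) (pos_word (a @ map (Pair b) (cancel_cons i u) @ w))"
proof (cases "u \<noteq> [] \<and> hd u = i")
  case True
  then obtain u' where u: "u = i # u'" by (cases u) auto
  then have "map (Pair b) u' @ w \<in> lists (indices n)"
    using assms by (auto simp: indices_def)
  from cancel_square[OF assms(1,4) this] show ?thesis
    by (simp add: u)
next
  case False
  then have c: "cancel_cons i u = i # u" by (cases u) auto
  have "a @ (b, i) # map (Pair b) u @ w \<in> lists (indices n)"
    using assms by (auto simp: indices_def)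
  from equivalent_refl[OF pos_word_letters[OF this]] show ?thesis
    by (simp add: c)
qed

text \<open>
  Bringing a letter of the second factor to its place costs one commutation for every letter of the first
  component.
\<close>

lemma commute_past:
  assumes "(False, i) \<in> indices n" "u \<in> lists {..<n}" "w \<in> lists (indices n)"
  shows "equivalent n (pos_word ((False, i) # map (Pair True) u @ w)) (pos_word (map (Pair True) u @ (False, i) # w))"
  using assms(2)
proof (induction u)
  case Nil
  have "(False, i) # w \<in> lists (indices n)" using assms by auto
  from equivalent_refl[OF pos_word_letters[OF this]] show ?case by simp
next
  case (Cons j u)
  have j: "(True, j) \<in> indices n" and u: "map (Pair True) u @ w \<in> lists (indices n)"
    using Cons assms by (auto simp: indices_def)
  have "equivalent n (pos_word ([] @ [(False, i), (True, j)] @ (map (Pair True) u @ w)))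
      (pos_word ([] @ [(True, j), (False, i)] @ (map (Pair True) u @ w)))"
    by (rule pos_word_context) (use commute_equivalent[of True j n i] assms(1) j u in simp_all)
  also have "equivalent n (pos_word ([] @ [(True, j), (False, i)] @ (map (Pair True) u @ w)))
      (pos_word ([(True, j)] @ (map (Pair True) u @ (False, i) # w) @ []))"
    using pos_word_context[of n "(False, i) # map (Pair True) u @ w" "map (Pair True) u @ (False, i) # w" "[(True, j)]" "[]"]
      Cons j by simp
  finally show ?case by simp
qed

lemma act_equivalent:
  assumes x: "x \<in> indices n" and p: "p \<in> reduced_pairs n"
  shows "equivalent n (pos_word (x # normal_form p)) (pos_word (normal_form (act x p)))"
proof -
  obtain b i where xi: "x = (b, i)" by (cases x)
  obtain u v where pu: "p = (u, v)" by (cases p)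
  have u: "u \<in> lists {..<n}" and v: "v \<in> lists {..<n}"
    using p by (auto simp: pu reduced_words_def)
  have mu: "map (Pair b) u \<in> lists (indices n)" "map (Pair b) v \<in> lists (indices n)" for b
    using u v by (auto simp: indices_def)
  show ?thesis
  proof (cases b)
    case True
    then show ?thesis
      using cancel_cons_equivalent[of True i n u "map (Pair False) v" "[]"] x u mu
      by (simp add: xi pu normal_form_def)
  next
    case False
    have "equivalent n (pos_word ((False, i) # map (Pair True) u @ map (Pair False) v))
        (pos_word (map (Pair True) u @ (False, i) # map (Pair False) v))"
      by (rule commute_past) (use x xi False u mu in auto)
    also have "equivalent n (pos_word (map (Pair True) u @ (False, i) # map (Pair False) v))
        (pos_word (map (Pair True) u @ map (Pair False) (cancel_cons i v)))"
      using cancel_cons_equivalent[of False i n v "[]" "map (Pair True) u"] x xi False v mu by simp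
    finally show ?thesis
      using False by (simp add: xi pu normal_form_def)
  qed
qed

text \<open>
  Completeness of the relators: every word reduces to a normal form by the relators alone. Since normal forms
  with the same value are equal, words with the same value are equivalent.
\<close>

lemma equivalent_normal_form:
  assumes "w \<in> lists (letters (generators n))"
  shows "\<exists>p\<in>reduced_pairs n. equivalent n w (pos_word (normal_form p))"
  using assms
proof (induction w)
  case Nil
  have "equivalent n [] (pos_word (normal_form ([], [])))"
    by (simp add: normal_form_def equivalent_refl)
  then show ?case using Nil_reduced by blast
next
  case (Cons l w)
  then obtain p where p: "p \<in> reduced_pairs n" "equivalent n w (pos_word (normal_form p))" by auto
  obtain x c where x: "x \<in> indices n" "l = (generator x, c)"
    using Cons by (auto simp: letters_def generators_def)
  have l: "equivalent n [l] (pos_word [x])"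
  proof (cases c)
    case True
    then show ?thesis
      using equivalent_refl[OF pos_word_letters[of "[x]" n]] x by simp
  next
    case False
    then show ?thesis using inverse_letter_equivalent[OF x(1)] x by simp
  qed
  have nf: "pos_word (normal_form p) \<in> lists (letters (generators n))"
    using pos_word_letters[OF normal_form_indices[OF p(1)]] .
  have "equivalent n ([l] @ w @ []) ([l] @ pos_word (normal_form p) @ [])"
    by (rule equivalent_context[OF p(2)]) (use Cons in auto)
  also have "equivalent n ([l] @ pos_word (normal_form p) @ []) ([] @ pos_word [x] @ pos_word (normal_form p))"
    using equivalent_context[OF l _ nf, of "[]"] by simp
  also have "equivalent n ([] @ pos_word [x] @ pos_word (normal_form p)) (pos_word (normal_form (act x p)))"
    using act_equivalent[OF x(1) p(1)] by simp
  finally have "equivalent n (l # w) (pos_word (normal_form (act x p)))" by simp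
  then show ?case
    by (rule bexI[where x = "act x p"]) (rule act_reduced[OF x(1) p(1)])
qed

lemma eval_pos_word:
  assumes "xs \<in> lists (indices n)"
  shows "eval_word (square_group n) (pos_word xs) = pair_code (foldr act xs ([], []))"
proof -
  have "eval_word (square_group n) (pos_word xs)
      = foldr (\<lambda>s h. s \<otimes>\<^bsub>square_group n\<^esub> h) (map generator xs) \<one>\<^bsub>square_group n\<^esub>"
    by (induction xs) (auto simp: eval_letter_def)
  then show ?thesis using product_of_generators[OF assms] by simp
qed

lemma eval_normal_form:
  assumes "p \<in> reduced_pairs n"
  shows "eval_word (square_group n) (pos_word (normal_form p)) = pair_code p"
  using eval_pos_word[OF normal_form_indices[OF assms]] foldr_act_normal_form[OF assms] by simp

lemma has_presentation_square_group: "has_presentation (square_group n) (generators n) (relators n)"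
proof -
  interpret group "square_group n" by (rule group_square_group)
  let ?L = "lists (letters (generators n))"
  have snd: "eval_word (square_group n) v = eval_word (square_group n) w" if "equivalent n v w" for v w
    using word_equiv_imp_eval_eq[OF generators_carrier relators_letters eval_relators] that
    unfolding equivalent_def by blast
  have image: "eval_word (square_group n) ` ?L = carrier (square_group n)"
  proof
    show "eval_word (square_group n) ` ?L \<subseteq> carrier (square_group n)"
      using eval_word_closed[OF generators_carrier] by blast
    show "carrier (square_group n) \<subseteq> eval_word (square_group n) ` ?L"
    proof
      fix g assume "g \<in> carrier (square_group n)"
      then obtain p where p: "p \<in> reduced_pairs n" "g = pair_code p"
        unfolding carrier_square_group by blast
      then have "g = eval_word (square_group n) (pos_word (normal_form p))"
        using eval_normal_form by simp
      then show "g \<in> eval_word (square_group n) ` ?L"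
        using pos_word_letters[OF normal_form_indices[OF p(1)]] by (rule image_eqI)
    qed
  qed
  have "equivalent n v w" if vw: "v \<in> ?L" "w \<in> ?L" "eval_word (square_group n) v = eval_word (square_group n) w" for v w
  proof -
    obtain p where p: "p \<in> reduced_pairs n" "equivalent n v (pos_word (normal_form p))"
      using equivalent_normal_form[OF vw(1)] by blast
    obtain q where q: "q \<in> reduced_pairs n" "equivalent n w (pos_word (normal_form q))"
      using equivalent_normal_form[OF vw(2)] by blast
    have "pair_code p = pair_code q"
      using snd[OF p(2)] snd[OF q(2)] vw(3) eval_normal_form[OF p(1)] eval_normal_form[OF q(1)] by simp
    then have "p = q" by simp
    then show ?thesis
      using equivalent_trans[OF p(2) equivalent_sym] q(2) by blast
  qed
  with snd have "\<forall>v\<in>?L. \<forall>w\<in>?L.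
      eval_word (square_group n) v = eval_word (square_group n) w \<longleftrightarrow> equivalent n v w"
    by meson
  with image show ?thesis
    unfolding has_presentation_def equivalent_def
    by (intro conjI group_square_group generators_carrier relators_letters)
qed

lemma label_generators:
  assumes "x \<in> indices n" "y \<in> indices n"
  shows "cox_label (square_group n) (generator x) (generator y)
     = (if x = y then 1 else if fst x = fst y then 0 else 2)"
proof (cases "x = y")
  case True
  then show ?thesis using label_same assms by simp
next
  case False
  obtain b i c j where eq: "x = (b, i)" "y = (c, j)" by (cases x; cases y)
  show ?thesis
  proof (cases "b = c")
    case True
    with False eq have "y = (b, j)" "i \<noteq> j" by auto
    then show ?thesis
      using False label_same_side[of b i n j] assms eq by simp
  next
    case bc: False
    then have "y = (\<not> b, j)" using eq by simp
    then have "cox_label (square_group n) (generator x) (generator y) = 2"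
      using label_opposite[of b i n j] assms eq by simp
    then show ?thesis using False bc eq by simp
  qed
qed

lemma coxeter_matrix_square_group: "coxeter_matrix (generators n) (cox_label (square_group n))"
  by (auto simp: coxeter_matrix_def generators_def label_generators)

lemma coxeter_system_square_group: "coxeter_system (square_group n) (generators n)"
  unfolding coxeter_system_def
  using group_square_group finite_generators generators_carrier coxeter_matrix_square_group
    has_presentation_square_group by blast

section \<open>Growth\<close>

definition pair_length :: "nat list \<times> nat list \<Rightarrow> nat" where
  "pair_length p = length (fst p) + length (snd p)"

lemma pair_length_act: "pair_length (act x p) \<le> Suc (pair_length p)"
proof -
  have "length (cancel_cons a w) \<le> Suc (length w)" for a w
    by (cases w) auto
  then show ?thesis
    by (cases x; cases p) (auto simp: pair_length_def)
qed

lemma pair_length_foldr_act: "pair_length (foldr act xs ([], [])) \<le> length xs"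
proof (induction xs)
  case (Cons x xs)
  then show ?case using pair_length_act[of x "foldr act xs ([], [])"] by simp
qed (simp add: pair_length_def)

text \<open>
  The normal form is a word of the required length; no word is shorter, because one letter changes the total
  length of a pair by at most one.
\<close>

lemma word_length_pair_code:
  assumes p: "p \<in> reduced_pairs n"
  shows "word_length (square_group n) (generators n) (pair_code p) = pair_length p"
  unfolding word_length_def
proof (rule Least_equality)
  have "map generator (normal_form p) \<in> lists (generators n)"
    using normal_form_indices[OF p] by (auto simp: generators_def)
  moreover have "length (map generator (normal_form p)) = pair_length p"
    by (simp add: normal_form_def pair_length_def)
  ultimately show "\<exists>w\<in>lists (generators n). length w = pair_length p \<and>
      foldr (\<lambda>s h. s \<otimes>\<^bsub>square_group n\<^esub> h) w \<one>\<^bsub>square_group n\<^esub> = pair_code p"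
    using product_of_generators[OF normal_form_indices[OF p]] foldr_act_normal_form[OF p] by metis
next
  fix l
  assume "\<exists>w\<in>lists (generators n). length w = l \<and>
      foldr (\<lambda>s h. s \<otimes>\<^bsub>square_group n\<^esub> h) w \<one>\<^bsub>square_group n\<^esub> = pair_code p"
  then obtain w where w: "w \<in> lists (generators n)" "length w = l"
    "foldr (\<lambda>s h. s \<otimes>\<^bsub>square_group n\<^esub> h) w \<one>\<^bsub>square_group n\<^esub> = pair_code p"
    by blast
  from w(1) obtain xs where xs: "xs \<in> lists (indices n)" "w = map generator xs"
    unfolding generators_def lists_image by blast
  then have "foldr act xs ([], []) = p"
    using w(3) product_of_generators[OF xs(1)] by simp
  then show "pair_length p \<le> l"
    using pair_length_foldr_act[of xs] w(2) xs(2) by simp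
qed

lemma growth_coeff_square_group:
  "growth_coeff (square_group n) (generators n) l = card {p \<in> reduced_pairs n. pair_length p = l}"
proof -
  have "{g \<in> carrier (square_group n). word_length (square_group n) (generators n) g = l}
    = pair_code ` {p \<in> reduced_pairs n. pair_length p = l}"
    unfolding carrier_square_group using word_length_pair_code by auto
  moreover have "inj_on pair_code A" for A
    by (rule inj_on_subset[OF inj_pair_code subset_UNIV])
  ultimately show ?thesis
    by (simp add: growth_coeff_def card_image)
qed

definition word_sphere :: "nat \<Rightarrow> nat \<Rightarrow> nat list set" where
  "word_sphere n l = {w \<in> reduced_words n. length w = l}"

lemma finite_word_sphere: "finite (word_sphere n l)"
  by (rule finite_subset[OF _ finite_lists_length_eq[of "{..<n}" l]])
    (auto simp: word_sphere_def reduced_words_def)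

lemma word_sphere_0: "word_sphere n 0 = {[]}"
  by (auto simp: word_sphere_def reduced_words_def)

text \<open>
  A nonempty reduced word can be extended on the left by any letter but its first.
\<close>

lemma card_word_sphere_Suc: "card (word_sphere n (Suc l)) = n * (n - 1) ^ l"
proof (induction l)
  case 0
  have "word_sphere n (Suc 0) = (\<lambda>a. [a]) ` {..<n}"
    by (auto simp: word_sphere_def reduced_words_def length_Suc_conv)
  then show ?case by (simp add: card_image inj_on_def)
next
  case (Suc l)
  have "word_sphere n (Suc (Suc l)) = (\<lambda>(w, a). a # w) ` (SIGMA w:word_sphere n (Suc l). {..<n} - {hd w})"
  proof (intro subset_antisym subsetI)
    fix v assume v: "v \<in> word_sphere n (Suc (Suc l))"
    then obtain a b w where "v = a # b # w"
      by (auto simp: word_sphere_def length_Suc_conv)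
    with v show "v \<in> (\<lambda>(w, a). a # w) ` (SIGMA w:word_sphere n (Suc l). {..<n} - {hd w})"
      by (intro image_eqI[of _ _ "(b # w, a)"]) (auto simp: word_sphere_def reduced_words_def)
  next
    fix v assume "v \<in> (\<lambda>(w, a). a # w) ` (SIGMA w:word_sphere n (Suc l). {..<n} - {hd w})"
    then show "v \<in> word_sphere n (Suc (Suc l))"
      by (auto simp: word_sphere_def reduced_words_def distinct_adj_Cons)
  qed
  moreover have "inj_on (\<lambda>(w, a). a # w) (SIGMA w:word_sphere n (Suc l). {..<n} - {hd w})"
    by (auto simp: inj_on_def)
  ultimately have "card (word_sphere n (Suc (Suc l))) = card (SIGMA w:word_sphere n (Suc l). {..<n} - {hd w})"
    by (simp add: card_image)
  also have "\<dots> = (\<Sum>w\<in>word_sphere n (Suc l). card ({..<n} - {hd w}))"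
    by (rule card_SigmaI) (auto simp: finite_word_sphere)
  also have "\<dots> = (\<Sum>w\<in>word_sphere n (Suc l). n - 1)"
  proof (rule sum.cong[OF HOL.refl])
    fix w assume "w \<in> word_sphere n (Suc l)"
    then have "hd w \<in> {..<n}"
      by (cases w) (auto simp: word_sphere_def reduced_words_def)
    then show "card ({..<n} - {hd w}) = n - 1" by simp
  qed
  finally show ?case using Suc by simp
qed

lemma card_word_sphere_le: "n \<ge> 2 \<Longrightarrow> card (word_sphere n l) \<le> n * (n - 1) ^ l"
proof (cases l)
  case (Suc m)
  assume "n \<ge> 2"
  then show ?thesis by (simp add: Suc card_word_sphere_Suc)
qed (simp add: word_sphere_0)

lemma card_word_sphere_ge: "n \<ge> 1 \<Longrightarrow> (n - 1) ^ l \<le> card (word_sphere n l)"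
  by (cases l) (auto simp: word_sphere_0 card_word_sphere_Suc)

lemma growth_coeff_upper:
  assumes "n \<ge> 2"
  shows "growth_coeff (square_group n) (generators n) l \<le> Suc l * (n\<^sup>2 * (n - 1) ^ l)"
proof -
  let ?U = "\<Union>i\<in>{..l}. word_sphere n i \<times> word_sphere n (l - i)"
  have "growth_coeff (square_group n) (generators n) l \<le> card ?U"
    unfolding growth_coeff_square_group
  proof (rule card_mono)
    show "finite ?U" by (simp add: finite_word_sphere)
    show "{p \<in> reduced_pairs n. pair_length p = l} \<subseteq> ?U"
      by (auto simp: pair_length_def word_sphere_def)
  qed
  also have "\<dots> \<le> (\<Sum>i\<in>{..l}. card (word_sphere n i \<times> word_sphere n (l - i)))"
    by (rule card_UN_le) simp
  also have "\<dots> \<le> (\<Sum>i\<in>{..l}. n\<^sup>2 * (n - 1) ^ l)"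
  proof (rule sum_mono)
    fix i assume i: "i \<in> {..l}"
    have "card (word_sphere n i \<times> word_sphere n (l - i)) \<le> (n * (n - 1) ^ i) * (n * (n - 1) ^ (l - i))"
      unfolding card_cartesian_product using assms by (intro mult_le_mono card_word_sphere_le)
    also have "\<dots> = n\<^sup>2 * (n - 1) ^ (i + (l - i))"
      by (simp only: power_add power2_eq_square ac_simps)
    finally show "card (word_sphere n i \<times> word_sphere n (l - i)) \<le> n\<^sup>2 * (n - 1) ^ l"
      using i by simp
  qed
  finally show ?thesis by simp
qed

lemma growth_coeff_lower:
  assumes "n \<ge> 1"
  shows "(n - 1) ^ l \<le> growth_coeff (square_group n) (generators n) l"
proof -
  have "(n - 1) ^ l \<le> card (word_sphere n l \<times> {[] :: nat list})"
    using card_word_sphere_ge[OF assms] by (simp add: card_cartesian_product)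
  also have "card (word_sphere n l \<times> {[] :: nat list}) \<le> card {p \<in> reduced_pairs n. pair_length p = l}"
  proof (rule card_mono)
    show "finite {p \<in> reduced_pairs n. pair_length p = l}"
      by (rule finite_subset[of _ "\<Union>i\<in>{..l}. word_sphere n i \<times> word_sphere n (l - i)"])
        (auto simp: pair_length_def word_sphere_def finite_word_sphere[unfolded word_sphere_def])
    show "word_sphere n l \<times> {[]} \<subseteq> {p \<in> reduced_pairs n. pair_length p = l}"
      by (auto simp: word_sphere_def pair_length_def reduced_words_def)
  qed
  finally show ?thesis by (simp add: growth_coeff_square_group)
qed

text \<open>
  The bounds on the spheres differ by the polynomial factor \<open>(l + 1) n\<^sup>2\<close>, whose
  \<open>l\<close>-th root tends to 1. For \<open>l > 0\<close> it is at most \<open>2 n\<^sup>2 l\<close>,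
  and the roots of \<open>l\<close> have a known limit.
\<close>

lemma growth_rate_square_group:
  assumes n: "n \<ge> 2"
  shows "growth_rate (square_group n) (generators n) = real (n - 1)"
proof -
  let ?a = "\<lambda>l. real (growth_coeff (square_group n) (generators n) l)"
  have "(\<lambda>l. root l (?a l)) \<longlonglongrightarrow> real (n - 1)"
  proof (rule tendsto_sandwich)
    show "\<forall>\<^sub>F l in sequentially. real (n - 1) \<le> root l (?a l)"
      using eventually_gt_at_top[of 0]
    proof eventually_elim
      case (elim l)
      have r: "real (n - 1) = root l (real (n - 1) ^ l)"
        using elim by (simp add: real_root_power_cancel)
      have "real (n - 1) ^ l \<le> ?a l"
        using growth_coeff_lower[of n l] n by (metis of_nat_le_iff of_nat_power one_le_numeral order_trans)
      then have "root l (real (n - 1) ^ l) \<le> root l (?a l)"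
        using elim by (intro real_root_le_mono)
      with r show ?case by linarith
    qed
    show "\<forall>\<^sub>F l in sequentially. root l (?a l) \<le> root l (real (2 * n\<^sup>2)) * root l (real l) * real (n - 1)"
      using eventually_gt_at_top[of 0]
    proof eventually_elim
      case (elim l)
      have "growth_coeff (square_group n) (generators n) l \<le> Suc l * (n\<^sup>2 * (n - 1) ^ l)"
        by (rule growth_coeff_upper[OF n])
      also have "\<dots> \<le> (2 * l) * (n\<^sup>2 * (n - 1) ^ l)"
        using elim by (intro mult_le_mono) auto
      finally have "?a l \<le> real (2 * n\<^sup>2) * real l * real (n - 1) ^ l"
        by (simp add: algebra_simps flip: of_nat_power of_nat_mult)
      then have "root l (?a l) \<le> root l (real (2 * n\<^sup>2) * real l * real (n - 1) ^ l)"
        using elim by (intro real_root_le_mono)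
      also have "\<dots> = root l (real (2 * n\<^sup>2)) * root l (real l) * real (n - 1)"
        using elim by (simp add: real_root_mult real_root_power_cancel)
      finally show ?case .
    qed
    have "(\<lambda>l. root l (real (2 * n\<^sup>2)) * root l (real l) * real (n - 1)) \<longlonglongrightarrow> 1 * 1 * real (n - 1)"
      using n by (intro tendsto_intros LIMSEQ_root_const LIMSEQ_root) simp
    then show "(\<lambda>l. root l (real (2 * n\<^sup>2)) * root l (real l) * real (n - 1)) \<longlonglongrightarrow> real (n - 1)"
      by simp
  qed simp
  then have "(\<lambda>l. ereal (root l (?a l))) \<longlonglongrightarrow> ereal (real (n - 1))"
    by simp
  then have "limsup (\<lambda>l. ereal (root l (?a l))) = ereal (real (n - 1))"
    by (intro lim_imp_Limsup) simp_all
  then show ?thesis by (simp add: growth_rate_def)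
qed

lemma perron_growth_rate:
  assumes "n \<ge> 3"
  shows "perron_number (growth_rate (square_group n) (generators n))"
proof -
  have g: "growth_rate (square_group n) (generators n) = real (n - 1)"
    using assms by (intro growth_rate_square_group) simp
  show ?thesis
    unfolding g perron_number_def using assms by (auto intro: int_imp_algebraic_int)
qed

section \<open>The nerve\<close>

lemma (in group) infinite_generate:
  assumes "T \<subseteq> carrier G" "a \<in> generate G T" "ord a = 0"
  shows "infinite (generate G T)"
proof
  assume fin: "finite (generate G T)"
  have sub: "subgroup (generate G T) G" using generate_is_subgroup[OF assms(1)] .
  have a: "a \<in> carrier G" using subgroup.mem_carrier[OF sub assms(2)] .
  have pw: "a [^] k \<in> generate G T" for k :: nat
    by (induction k) (use sub assms(2) in \<open>auto intro: subgroup.m_closed subgroup.one_closed\<close>)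
  have "inj (\<lambda>k::nat. a [^] k)"
  proof (rule injI)
    fix i j :: nat assume "a [^] i = a [^] j"
    then have "a [^] (int i) = a [^] (int j)" by (simp add: int_pow_int)
    then show "i = j" using int_pow_eq[OF a, of "int i" "int j"] assms(3) by simp
  qed
  moreover have "finite (range (\<lambda>k::nat. a [^] k))"
    by (rule finite_subset[OF _ fin]) (use pw in auto)
  ultimately show False using finite_imageD infinite_UNIV_nat by blast
qed

lemma (in group) finite_generate_commuting_involutions:
  assumes st: "s \<in> carrier G" "t \<in> carrier G"
    and inv: "s \<otimes> s = \<one>" "t \<otimes> t = \<one>" and comm: "t \<otimes> s = s \<otimes> t"
  shows "finite (generate G {s, t})"
proof (rule finite_subset)
  have i: "inv s = s" "inv t = t"
    using inv st by (simp_all add: inv_equality)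
  have tst: "t \<otimes> (s \<otimes> t) = s" "s \<otimes> (s \<otimes> t) = t"
    using st inv comm by (simp_all add: m_assoc[symmetric]) (simp add: m_assoc)
  have sst: "s \<otimes> t \<otimes> s = t" "s \<otimes> t \<otimes> t = s" "s \<otimes> t \<otimes> (s \<otimes> t) = \<one>"
    using st inv comm tst by (simp_all add: m_assoc)
  show "generate G {s, t} \<subseteq> {\<one>, s, t, s \<otimes> t}"
  proof
    fix x assume "x \<in> generate G {s, t}"
    then show "x \<in> {\<one>, s, t, s \<otimes> t}"
    proof (induction rule: generate.induct)
      case (eng h1 h2)
      then show ?case using st inv comm tst sst by auto
    qed (use i in auto)
  qed
qed simp

definition nerve_edge :: "nat \<times> nat \<Rightarrow> nat list set set" where
  "nerve_edge e = {generator (True, fst e), generator (False, snd e)}"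

lemma act_commute: "fst x \<noteq> fst y \<Longrightarrow> act x (act y p) = act y (act x p)"
  by (cases x; cases y; cases p) auto

text \<open>
  The nerve is the complete bipartite graph on the two factors: two generators of one factor have a product of
  infinite order, while generators of different factors are commuting involutions and generate a group of
  order 4.
\<close>

lemma nerve_square_group:
  "nerve (square_group n) (generators n)
    = (\<lambda>x. {generator x}) ` indices n \<union> nerve_edge ` ({..<n} \<times> {..<n})"
proof (intro subset_antisym subsetI)
  interpret group "square_group n" by (rule group_square_group)
  have sq: "generator x \<otimes>\<^bsub>square_group n\<^esub> generator x = \<one>\<^bsub>square_group n\<^esub>" if "x \<in> indices n" for x
    by (subst generator_product[OF that that], cases x) (auto simp: one_square_group)
  have fin: "finite (generate (square_group n) {generator x, generator y})"
    if xy: "x \<in> indices n" "y \<in> indices n" "x = y \<or> fst x \<noteq> fst y" for x y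
  proof (rule finite_generate_commuting_involutions)
    show "generator y \<otimes>\<^bsub>square_group n\<^esub> generator x = generator x \<otimes>\<^bsub>square_group n\<^esub> generator y"
      unfolding generator_product[OF xy(1,2)] generator_product[OF xy(2,1)]
      using xy(3) act_commute[of x y] by auto
  qed (use xy sq generator_carrier in auto)
  {
    fix T assume "T \<in> nerve (square_group n) (generators n)"
    then have T: "T \<subseteq> generators n" "T \<noteq> {}" "finite (generate (square_group n) T)"
      by (auto simp: nerve_def)
    have unique: "i = j" if "generator (b, i) \<in> T" "generator (b, j) \<in> T" for b i j
    proof (rule ccontr)
      assume "i \<noteq> j"
      have ind: "(b, i) \<in> indices n" "(b, j) \<in> indices n"
        using that T(1) by (auto simp: generators_def)
      have "generator (b, i) \<otimes>\<^bsub>square_group n\<^esub> generator (b, j) \<in> generate (square_group n) T"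
        using that by (intro generate.eng generate.incl)
      moreover have "ord (generator (b, i) \<otimes>\<^bsub>square_group n\<^esub> generator (b, j)) = 0"
        using label_same_side[OF ind \<open>i \<noteq> j\<close>] by (simp add: cox_label_def)
      ultimately show False
        using infinite_generate[of T] T generators_carrier by blast
    qed
    have form: "\<exists>b i. g = generator (b, i) \<and> i < n" if gT: "g \<in> T" for g
      using gT T(1) by (auto simp: generators_def indices_def)
    show "T \<in> (\<lambda>x. {generator x}) ` indices n \<union> nerve_edge ` ({..<n} \<times> {..<n})"
    proof (cases "\<exists>i j. generator (True, i) \<in> T \<and> generator (False, j) \<in> T")
      case True
      then obtain i j where ij: "generator (True, i) \<in> T" "generator (False, j) \<in> T" by blast
      have "g = generator (True, i) \<or> g = generator (False, j)" if gT: "g \<in> T" for g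
      proof -
        obtain b k where "g = generator (b, k)" using form[OF gT] by blast
        then show ?thesis
          using unique[of True i k] unique[of False j k] ij gT by (cases b) auto
      qed
      then have "T = nerve_edge (i, j)"
        using ij by (auto simp: nerve_edge_def)
      moreover have "i < n" "j < n"
        using form[OF ij(1)] form[OF ij(2)] by auto
      ultimately show ?thesis by blast
    next
      case False
      obtain b i where bi: "generator (b, i) \<in> T" "i < n" using T(2) form by blast
      have "g = generator (b, i)" if gT: "g \<in> T" for g
      proof -
        obtain c k where g: "g = generator (c, k)" using form[OF gT] by blast
        then have "c = b" using False bi(1) gT by (cases b; cases c) auto
        then show ?thesis using unique[of b i k] bi(1) gT g by simp
      qed
      then have "T = {generator (b, i)}" using bi(1) by blast
      moreover have "(b, i) \<in> indices n" using bi(2) by (simp add: indices_def)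
      ultimately show ?thesis by blast
    qed
  next
    fix T assume "T \<in> (\<lambda>x. {generator x}) ` indices n \<union> nerve_edge ` ({..<n} \<times> {..<n})"
    then show "T \<in> nerve (square_group n) (generators n)"
    proof (elim UnE imageE)
      fix x assume "x \<in> indices n" "T = {generator x}"
      then show ?thesis
        using fin[of x x] generator_in_generators by (simp add: nerve_def)
    next
      fix e assume "T = nerve_edge e" "e \<in> {..<n} \<times> {..<n}"
      moreover from this have "(True, fst e) \<in> indices n" "(False, snd e) \<in> indices n"
        by (auto simp: indices_def)
      ultimately show ?thesis
        using fin[of "(True, fst e)" "(False, snd e)"] generator_in_generators
        by (simp add: nerve_def nerve_edge_def)
    qed
  }
qed

lemma coxeter_dim_square_group: "coxeter_dim (square_group n) (generators n) \<le> 2"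
proof -
  let ?K = "nerve (square_group n) (generators n)"
  have fin: "finite ?K" unfolding nerve_square_group by (simp add: indices_def)
  have "card T \<le> 2" if "T \<in> insert {} ?K" for T
    using that by (auto simp: nerve_square_group nerve_edge_def card_insert_if)
  then have "Max (card ` insert {} ?K) \<le> 2"
    using fin by (subst Max_le_iff) auto
  then show ?thesis by (simp add: coxeter_dim_def complex_dim_def)
qed

lemma euler_char_square_group: "euler_char (nerve (square_group n) (generators n)) = 2 * int n - (int n)\<^sup>2"
proof -
  let ?V = "(\<lambda>x. {generator x}) ` indices n" and ?E = "nerve_edge ` ({..<n} \<times> {..<n})"
  have cV: "card T = 1" if "T \<in> ?V" for T using that by auto
  have cE: "card T = 2" if "T \<in> ?E" for T using that by (auto simp: nerve_edge_def)
  have "?V \<inter> ?E = {}"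
  proof (rule ccontr)
    assume "?V \<inter> ?E \<noteq> {}"
    then obtain T where "T \<in> ?V" "T \<in> ?E" by blast
    with cV[of T] cE[of T] show False by simp
  qed
  moreover have "finite ?V" "finite ?E" by (auto simp: indices_def)
  ultimately have "euler_char (nerve (square_group n) (generators n))
    = (\<Sum>T\<in>?V. (-1) ^ (card T - 1)) + (\<Sum>T\<in>?E. (-1) ^ (card T - 1))"
    unfolding nerve_square_group euler_char_def by (intro sum.union_disjoint)
  also have "(\<Sum>T\<in>?V. (-1) ^ (card T - 1)) = (\<Sum>T\<in>?V. (1::int))"
    by (rule sum.cong) (simp_all add: cV)
  also have "(\<Sum>T\<in>?E. (-1) ^ (card T - 1)) = (\<Sum>T\<in>?E. (-1::int))"
    by (rule sum.cong) (simp_all add: cE)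
  also have "card ?V = 2 * n"
    by (subst card_image) (auto simp: inj_on_def indices_def card_cartesian_product)
  moreover have "card ?E = n * n"
    by (subst card_image) (auto simp: inj_on_def nerve_edge_def doubleton_eq_iff card_cartesian_product)
  ultimately show ?thesis by (simp add: power2_eq_square)
qed

lemma euler_char_square_group_le:
  assumes "n \<ge> 3"
  shows "euler_char (nerve (square_group n) (generators n)) \<le> -1"
proof -
  have "3 * int n \<le> int n * int n"
    using assms by (intro mult_right_mono) auto
  then show ?thesis
    unfolding euler_char_square_group power2_eq_square using assms by linarith
qed

section \<open>The cosine matrix\<close>

definition side :: "bool \<Rightarrow> nat \<Rightarrow> nat list set set" where
  "side b n = generator ` ({b} \<times> {..<n})"

lemma generators_sides: "generators n = side True n \<union> side False n"
  by (auto simp: generators_def side_def indices_def)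

lemma sides_disjoint: "side True n \<inter> side False n = {}"
  by (auto simp: side_def)

lemma card_side: "card (side b n) = n"
  by (simp add: side_def card_image[OF inj_on_generator] card_cartesian_product)

lemma finite_side: "finite (side b n)"
  by (simp add: side_def)

lemma mem_sideE:
  assumes "s \<in> side b n"
  obtains i where "s = generator (b, i)" "(b, i) \<in> indices n"
  using assms by (auto simp: side_def indices_def)

lemma label_side:
  "s \<in> side b n \<Longrightarrow> t \<in> side b n \<Longrightarrow> s \<noteq> t \<Longrightarrow> cox_label (square_group n) s t = 0"
  "s \<in> side b n \<Longrightarrow> t \<in> side (\<not> b) n \<Longrightarrow> cox_label (square_group n) s t = 2"
  by (elim mem_sideE; simp add: label_generators)+

text \<open>
  On the sum of the basis vectors of one factor, the \<open>n\<close> diagonal entries contribute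
  \<open>1\<close> each and the \<open>n (n - 1)\<close> others \<open>-1\<close> each.
\<close>

lemma quadratic_form_side:
  "(\<Sum>s\<in>generators n. \<Sum>t\<in>generators n.
      (if s \<in> side True n then 1 else 0) * cosine_matrix (square_group n) s t * (if t \<in> side True n then 1 else 0))
    = real n * (2 - real n)"
proof -
  let ?A = "side True n" and ?C = "cosine_matrix (square_group n)"
  let ?x = "\<lambda>s. if s \<in> ?A then 1 else 0 :: real"
  have fin: "finite ?A" by (simp add: side_def)
  have C: "?C s t = (if s = t then 2 else 0) - 1" if "s \<in> ?A" "t \<in> ?A" for s t
  proof (cases "s = t")
    case True
    then have "cox_label (square_group n) s t = 1"
      using that label_same by (auto simp: side_def indices_def)
    then show ?thesis using True by (simp add: cosine_matrix_def)
  next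
    case False
    then show ?thesis using label_side(1)[OF that False] by (simp add: cosine_matrix_def)
  qed
  have "(\<Sum>s\<in>generators n. \<Sum>t\<in>generators n. ?x s * ?C s t * ?x t) = (\<Sum>s\<in>?A. \<Sum>t\<in>?A. ?x s * ?C s t * ?x t)"
  proof -
    have "(\<Sum>t\<in>generators n. ?x s * ?C s t * ?x t) = (\<Sum>t\<in>?A. ?x s * ?C s t * ?x t)" for s
      by (rule sum.mono_neutral_right) (auto simp: generators_sides finite_side)
    then have "(\<Sum>s\<in>generators n. \<Sum>t\<in>generators n. ?x s * ?C s t * ?x t) = (\<Sum>s\<in>generators n. \<Sum>t\<in>?A. ?x s * ?C s t * ?x t)"
      by simp
    also have "\<dots> = (\<Sum>s\<in>?A. \<Sum>t\<in>?A. ?x s * ?C s t * ?x t)"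
      by (rule sum.mono_neutral_right) (auto simp: generators_sides finite_side)
    finally show ?thesis .
  qed
  also have "\<dots> = (\<Sum>s\<in>?A. \<Sum>t\<in>?A. (if s = t then 2 else 0) - 1)"
    by (intro sum.cong HOL.refl) (simp add: C)
  also have "\<dots> = (\<Sum>s\<in>?A. 2 - real n)"
    using fin by (intro sum.cong HOL.refl) (simp add: sum_subtractf card_side)
  also have "\<dots> = real n * (2 - real n)"
    by (simp add: card_side)
  finally show ?thesis .
qed

lemma not_affine_square_group:
  assumes "n \<ge> 3"
  shows "\<not> affine_system (square_group n) (generators n)"
proof
  assume "affine_system (square_group n) (generators n)"
  from this[unfolded affine_system_def positive_semidefinite_on_def, THEN spec,
      of "\<lambda>s. if s \<in> side True n then 1 else 0"]
  have "real n * (2 - real n) \<ge> 0"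
    unfolding quadratic_form_side .
  then show False using assms by (simp add: zero_le_mult_iff)
qed

lemma not_spherical_square_group:
  assumes "n \<ge> 3"
  shows "\<not> spherical (square_group n) (generators n)"
proof
  assume pd: "spherical (square_group n) (generators n)"
  have "generator (True, 0) \<in> generators n \<inter> side True n"
    using assms by (auto simp: generators_def side_def indices_def)
  then have "\<exists>s\<in>generators n. (if s \<in> side True n then 1 else 0 :: real) \<noteq> 0"
    by auto
  from pd[unfolded spherical_def positive_definite_on_def, THEN spec, THEN mp, OF this]
  have "real n * (2 - real n) > 0"
    unfolding quadratic_form_side .
  then show False using assms by (simp add: zero_less_mult_iff)
qed

section \<open>The infinite family\<close>

lemma not_hyperbolic_square_group:
  assumes "n \<ge> 3"
  shows "\<not> hyperbolic_system (square_group n) (generators n)"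
proof (rule not_hyperbolic_product)
  show "cox_label (square_group n) s t = 0" if "s \<in> side True n" "t \<in> side True n" "s \<noteq> t" for s t
    using label_side(1) that .
  show "cox_label (square_group n) s t = 0" if "s \<in> side False n" "t \<in> side False n" "s \<noteq> t" for s t
    using label_side(1) that .
  show "cox_label (square_group n) s t = 2" if "s \<in> side True n" "t \<in> side False n" for s t
    using label_side(2)[of s True n t] that by simp
  show "cox_label (square_group n) t s = 2" if "s \<in> side True n" "t \<in> side False n" for s t
    using label_side(2)[of t False n s] that by simp
qed (use assms in \<open>simp_all add: finite_side generators_sides sides_disjoint card_side\<close>)

lemma square_group_iso_imp_eq:
  assumes "coxeter_iso (square_group m) (generators m) (square_group n) (generators n)"
  shows "m = n"
  using assms card_generators unfolding coxeter_iso_def by (metis bij_betw_same_card mult_left_cancel zero_neq_numeral)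

theorem theorem3:
  shows "\<exists>\<X> :: (nat list set monoid \<times> nat list set set) set.
           infinite \<X> \<and>
           (\<forall>(G, S) \<in> \<X>.
              coxeter_system G S \<and>
              \<not> spherical G S \<and> \<not> affine_system G S \<and> \<not> hyperbolic_system G S \<and>
              coxeter_dim G S \<le> 2 \<and> euler_char (nerve G S) \<le> -1 \<and>
              perron_number (growth_rate G S)) \<and>
           (\<forall>(G, S) \<in> \<X>. \<forall>(H, T) \<in> \<X>.
              (G, S) \<noteq> (H, T) \<longrightarrow> \<not> coxeter_iso G S H T)"
proof -
  let ?X = "(\<lambda>n. (square_group n, generators n)) ` {3..}"
  have "inj_on (\<lambda>n. (square_group n, generators n)) {3..}"
    by (rule inj_onI) (metis card_generators prod.inject mult_left_cancel zero_neq_numeral)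
  then have "infinite ?X"
    using finite_imageD infinite_Ici by blast
  moreover have "\<forall>(G, S) \<in> ?X. coxeter_system G S \<and>
              \<not> spherical G S \<and> \<not> affine_system G S \<and> \<not> hyperbolic_system G S \<and>
              coxeter_dim G S \<le> 2 \<and> euler_char (nerve G S) \<le> -1 \<and>
              perron_number (growth_rate G S)"
    using coxeter_system_square_group not_spherical_square_group not_affine_square_group
      not_hyperbolic_square_group coxeter_dim_square_group euler_char_square_group_le perron_growth_rate
    by auto
  moreover have "\<forall>(G, S) \<in> ?X. \<forall>(H, T) \<in> ?X. (G, S) \<noteq> (H, T) \<longrightarrow> \<not> coxeter_iso G S H T"
    using square_group_iso_imp_eq by auto
  ultimately show ?thesis by (intro exI[of _ ?X] conjI)
qed

end
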